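(* Let $\ell\ge 1$ be an integer, let $X$ be a (finite, nonempty) cell complex, and let $L_{\ell-1}$ be the lifetime sum of the $(\ell-1)$-st reduced persistent homology of the $\ell$-Bernoulli cell complex process on $X$. Then $$\mathbb{E}[L_{\ell-1}]=\int_0^1 \frac{1-t}{t}\cdot\frac{\partial_xT_\ell\left(X;\frac{1}{t},\frac{1}{1-t}\right)}{T_\ell\left(X;\frac{1}{t},\frac{1}{1-t}\right)}\,dt,$$ where $T_\ell(X;x,y)$ is the (reduced) $\ell$-Tutte polynomial of $X$ and $\partial_x T_\ell$ is its partial derivative in the first variable $x$.
   Context: All cell complexes are finite. $X_\ell$ denotes the set of $\ell$-cells of $X$ and $X^{\ell-1}$ its $(\ell-1)$-skeleton. For $F\subset X_\ell$, put $X_F=X^{\ell-1}\sqcup F$, a subcomplex of $X$. Homology is cellular with coefficients in a field $K$ of characteristic zero; $\tilde\beta_k$ denotes the $k$-th reduced Betti number over $K$. $\ell$-Tutte polynomial: $$T_\ell(X;x,y)=\sum_{F\subset X_\ell}(x-1)^{\tilde\beta_{\ell-1}(X_F)}(y-1)^{\tilde\beta_\ell(X_F)}.$$ Bernoulli process: let $\{t_\sigma:\sigma\in X_\ell\}$ be i.i.d. random variables uniform on $[0,1]$. The $\ell$-Bernoulli cell complex process on $X$ is the random filtration $X^\ell(t)=X^{\ell-1}\sqcup\{\sigma\in X_\ell: t_\sigma\le t\}$, $0\le t\le 1$ (saturation time $T=1$). Lifetime sum: the persistent homology of the filtration in degree $k$ decomposes into finitely many intervals with birth time $b_i$ and death time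 $d_i$ (a class born at $b_i$ persists for $b_i\le t<d_i$); classes that never die are assigned death time $d_i=T=1$. The lifetime is $d_i-b_i$, and $L_k$ is the sum of all lifetimes in the $k$-th reduced persistent homology (for $k=0$ one generator of maximal lifetime is omitted). Equivalently, $L_k=\int_0^1\tilde\beta_k(X^\ell(t))\,dt$. *)

theory Defs
  imports
    "HOL-Homology.Homology"
    "HOL-Probability.Probability"
    "HOL-Library.Function_Algebras"
begin

section \<open>Finite cell complexes\<close>

definition unit_disc :: "nat \<Rightarrow> (nat \<Rightarrow> real) topology" where
  "unit_disc k = subtopology (Euclidean_space k) {x. (\<Sum>i<k. (x i)\<^sup>2) \<le> 1}"

definition disc_boundary :: "nat \<Rightarrow> (nat \<Rightarrow> real) set" where
  "disc_boundary k = {x \<in> topspace (unit_disc k). (\<Sum>i<k. (x i)\<^sup>2) = 1}"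

definition open_disc :: "nat \<Rightarrow> (nat \<Rightarrow> real) set" where
  "open_disc k = {x \<in> topspace (unit_disc k). (\<Sum>i<k. (x i)\<^sup>2) < 1}"

text \<open>
  A cell complex is a space together with a set of labels for the cells of each dimension and
  a characteristic map (defined on the closed unit disc) for each cell. A label may be used in
  several dimensions; a cell is a pair of a dimension and a label.
\<close>

record ('a, 'c) cell_complex =
  top_space :: "'a topology"
  cells :: "nat \<Rightarrow> 'c set"
  char_map :: "nat \<Rightarrow> 'c \<Rightarrow> (nat \<Rightarrow> real) \<Rightarrow> 'a"

definition open_cell :: "('a, 'c) cell_complex \<Rightarrow> nat \<Rightarrow> 'c \<Rightarrow> 'a set" where
  "open_cell X k \<sigma> = char_map X k \<sigma> ` open_disc k"

text \<open>The dimension is an integer, so that the skeleton of dimension \<open>-1\<close> is the empty set.\<close>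

definition skeleton :: "('a, 'c) cell_complex \<Rightarrow> int \<Rightarrow> 'a set" where
  "skeleton X k = (\<Union>j\<in>{j. int j \<le> k}. \<Union>\<sigma>\<in>cells X j. open_cell X j \<sigma>)"

definition skeleton_space :: "('a, 'c) cell_complex \<Rightarrow> int \<Rightarrow> 'a topology" where
  "skeleton_space X k = subtopology (top_space X) (skeleton X k)"

text \<open>
  Finite CW complexes. The weak-topology axiom (a set is closed iff its preimages under all
  characteristic maps are closed) is not listed: since there are finitely many cells, it follows
  from the compactness of the discs and the Hausdorff property. For the same reason a
  characteristic map that is injective on the open disc is a homeomorphism from it onto the cell.
\<close>

definition finite_cell_complex :: "('a, 'c) cell_complex \<Rightarrow> bool" where
  "finite_cell_complex X \<longleftrightarrow>
     Hausdorff_space (top_space X) \<and>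
     finite (SIGMA k:UNIV. cells X k) \<and>
     (\<forall>k. \<forall>\<sigma>\<in>cells X k.
        continuous_map (unit_disc k) (top_space X) (char_map X k \<sigma>) \<and>
        inj_on (char_map X k \<sigma>) (open_disc k) \<and>
        char_map X k \<sigma> ` disc_boundary k \<subseteq> skeleton X (int k - 1)) \<and>
     disjoint_family_on (\<lambda>(k, \<sigma>). open_cell X k \<sigma>) (SIGMA k:UNIV. cells X k) \<and>
     topspace (top_space X) = (\<Union>k. \<Union>\<sigma>\<in>cells X k. open_cell X k \<sigma>)"

text \<open>\<open>X\<^sub>F\<close>: the \<open>(l-1)\<close>-skeleton of \<open>X\<close> together with the \<open>l\<close>-cells in \<open>F\<close>.\<close>

definition add_cells :: "('a, 'c) cell_complex \<Rightarrow> nat \<Rightarrow> 'c set \<Rightarrow> ('a, 'c) cell_complex" where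
  "add_cells X l F =
     \<lparr>top_space = subtopology (top_space X)
                    (skeleton X (int l - 1) \<union> (\<Union>\<sigma>\<in>F. open_cell X l \<sigma>)),
      cells = (\<lambda>k. if k < l then cells X k else if k = l then F else {}),
      char_map = char_map X\<rparr>"


section \<open>Cellular homology over a field of characteristic zero\<close>

text \<open>
  A generator of \<open>H\<^sub>k(D\<^sup>k, S\<^sup>k\<^sup>-\<^sup>1) \<cong> \<int>\<close>, i.e. an orientation of the standard disc. The choice changes
  all incidence numbers in a given dimension by a common sign.
\<close>

definition disc_class :: "nat \<Rightarrow> (nat \<Rightarrow> real) chain set" where
  "disc_class k =
     (SOME a. a \<in> carrier (relative_homology_group (int k) (unit_disc k) (disc_boundary k)) \<and>
        generate (relative_homology_group (int k) (unit_disc k) (disc_boundary k)) {a} =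
        carrier (relative_homology_group (int k) (unit_disc k) (disc_boundary k)))"

text \<open>\<open>C\<^sub>k = H\<^sub>k(X\<^sup>k, X\<^sup>k\<^sup>-\<^sup>1)\<close>, which is free abelian (written multiplicatively in the library)
  with the classes \<open>cell_class X k \<sigma>\<close> of the \<open>k\<close>-cells as a basis.\<close>

definition cellular_group :: "('a, 'c) cell_complex \<Rightarrow> nat \<Rightarrow> 'a chain set monoid" where
  "cellular_group X k =
     relative_homology_group (int k) (skeleton_space X (int k)) (skeleton X (int k - 1))"

definition cell_class :: "('a, 'c) cell_complex \<Rightarrow> nat \<Rightarrow> 'c \<Rightarrow> 'a chain set" where
  "cell_class X k \<sigma> =
     hom_induced (int k) (unit_disc k) (disc_boundary k)
       (skeleton_space X (int k)) (skeleton X (int k - 1)) (char_map X k \<sigma>) (disc_class k)"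

text \<open>\<open>incidence X k \<sigma> \<tau>\<close> is the incidence number of the \<open>(k+1)\<close>-cell \<open>\<sigma>\<close> and the \<open>k\<close>-cell \<open>\<tau>\<close>:
  the coefficient of \<open>\<tau>\<close> in the image of \<open>\<sigma>\<close> under the boundary map
  \<open>H\<^sub>k\<^sub>+\<^sub>1(X\<^sup>k\<^sup>+\<^sup>1, X\<^sup>k) \<rightarrow> H\<^sub>k(X\<^sup>k, X\<^sup>k\<^sup>-\<^sup>1)\<close> of the triple.\<close>

definition incidence :: "('a, 'c) cell_complex \<Rightarrow> nat \<Rightarrow> 'c \<Rightarrow> 'c \<Rightarrow> int" where
  "incidence X k \<sigma> =
     (SOME n. hom_relboundary (int k + 1) (skeleton_space X (int k + 1))
                (skeleton X (int k)) (skeleton X (int k - 1)) (cell_class X (Suc k) \<sigma>) =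
              finprod (cellular_group X k)
                (\<lambda>\<tau>. cell_class X k \<tau> [^]\<^bsub>cellular_group X k\<^esub> (n \<tau> :: int)) (cells X k))"

definition scale_chain :: "'k::field \<Rightarrow> ('c \<Rightarrow> 'k) \<Rightarrow> 'c \<Rightarrow> 'k" where
  "scale_chain a c = (\<lambda>\<sigma>. a * c \<sigma>)"

global_interpretation chain: vector_space scale_chain
  by standard (auto simp: scale_chain_def algebra_simps fun_eq_iff)

text \<open>Chains with coefficients in \<open>'k\<close> are functions on cell labels vanishing off the \<open>k\<close>-cells;
  hence the chains of a subcomplex are literally chains of the whole complex.\<close>

definition cellular_chains :: "('a, 'c) cell_complex \<Rightarrow> nat \<Rightarrow> ('c \<Rightarrow> 'k::field_char_0) set" where
  "cellular_chains X k = {c. \<forall>\<sigma>. \<sigma> \<notin> cells X k \<longrightarrow> c \<sigma> = 0}"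

text \<open>The boundary map from \<open>(k+1)\<close>-chains to \<open>k\<close>-chains.\<close>

definition cellular_boundary ::
    "('a, 'c) cell_complex \<Rightarrow> nat \<Rightarrow> ('c \<Rightarrow> 'k::field_char_0) \<Rightarrow> 'c \<Rightarrow> 'k" where
  "cellular_boundary X k c =
     (\<lambda>\<tau>. if \<tau> \<in> cells X k then \<Sum>\<sigma>\<in>cells X (Suc k). of_int (incidence X k \<sigma> \<tau>) * c \<sigma> else 0)"

text \<open>Reduced cycles: in degree zero the boundary map is replaced by the augmentation.\<close>

fun reduced_cycles :: "('a, 'c) cell_complex \<Rightarrow> nat \<Rightarrow> ('c \<Rightarrow> 'k::field_char_0) set" where
  "reduced_cycles X 0 = {c \<in> cellular_chains X 0. (\<Sum>v\<in>cells X 0. c v) = 0}"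
| "reduced_cycles X (Suc k) = {c \<in> cellular_chains X (Suc k). cellular_boundary X k c = 0}"

definition boundaries :: "('a, 'c) cell_complex \<Rightarrow> nat \<Rightarrow> ('c \<Rightarrow> 'k::field_char_0) set" where
  "boundaries X k = cellular_boundary X k ` cellular_chains X (Suc k)"

text \<open>The dimension of the quotient of the (finite-dimensional) space of reduced cycles by its
  subspace of boundaries.\<close>

definition reduced_betti :: "'k::field_char_0 itself \<Rightarrow> nat \<Rightarrow> ('a, 'c) cell_complex \<Rightarrow> nat" where
  "reduced_betti _ k X =
     chain.dim (reduced_cycles X k :: ('c \<Rightarrow> 'k) set) - chain.dim (boundaries X k :: ('c \<Rightarrow> 'k) set)"

definition tutte ::
    "'k::field_char_0 itself \<Rightarrow> nat \<Rightarrow> ('a, 'c) cell_complex \<Rightarrow> real \<Rightarrow> real \<Rightarrow> real" where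
  "tutte K l X x y =
     (\<Sum>F\<in>Pow (cells X l). (x - 1) ^ reduced_betti K (l - 1) (add_cells X l F) *
                             (y - 1) ^ reduced_betti K l (add_cells X l F))"


section \<open>Persistent homology over the time interval \<open>[0, 1]\<close>\<close>

text \<open>
  The list \<open>bs\<close> of pairs (birth, death) is the barcode of the \<open>k\<close>-th reduced persistent homology of
  the increasing family \<open>Y\<close>, that is, the persistence module decomposes as the direct sum of the
  interval modules of the \<open>[b\<^sub>i, d\<^sub>i)\<close>. The cycle \<open>z i\<close> represents the generator of the \<open>i\<close>-th summand:
  it exists from time \<open>b\<^sub>i\<close> on, its class is zero from time \<open>d\<^sub>i\<close> on, and at each time the classes of
  those \<open>z i\<close> that are alive form a basis of the homology. Death time \<open>\<infinity>\<close> means that the class is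
  still alive at time \<open>1\<close>.
\<close>

definition barcode ::
    "'k::field_char_0 itself \<Rightarrow> nat \<Rightarrow> (real \<Rightarrow> ('a, 'c) cell_complex) \<Rightarrow> (real \<times> ereal) list \<Rightarrow> bool"
  where
  "barcode _ k Y bs \<longleftrightarrow>
     (\<forall>(b, d)\<in>set bs. b \<in> {0..1} \<and> ereal b < d \<and> (d \<le> 1 \<or> d = \<infinity>)) \<and>
     (\<exists>z :: nat \<Rightarrow> 'c \<Rightarrow> 'k.
        (\<forall>i<length bs. z i \<in> reduced_cycles (Y (fst (bs ! i))) k) \<and>
        (\<forall>s\<in>{0..1}.
           (\<forall>i<length bs. snd (bs ! i) \<le> ereal s \<longrightarrow> z i \<in> boundaries (Y s) k) \<and>
           (let alive = {i. i < length bs \<and> fst (bs ! i) \<le> s \<and> ereal s < snd (bs ! i)} in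
              \<forall>c\<in>reduced_cycles (Y s) k. \<exists>!a. (\<forall>i. i \<notin> alive \<longrightarrow> a i = 0) \<and>
                 c - (\<Sum>i\<in>alive. scale_chain (a i) (z i)) \<in> boundaries (Y s) k)))"

text \<open>A class that never dies is assigned the death time \<open>1\<close>.\<close>

definition total_lifetime :: "(real \<times> ereal) list \<Rightarrow> real" where
  "total_lifetime bs = (\<Sum>(b, d)\<leftarrow>bs. real_of_ereal (min d 1) - b)"

text \<open>Well defined, as the barcode is unique up to the order of the list.\<close>

definition lifetime_sum ::
    "'k::field_char_0 itself \<Rightarrow> nat \<Rightarrow> (real \<Rightarrow> ('a, 'c) cell_complex) \<Rightarrow> real" where
  "lifetime_sum K k Y = (THE L. \<exists>bs. barcode K k Y bs \<and> L = total_lifetime bs)"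


section \<open>The Bernoulli cell complex process\<close>

definition bernoulli_process ::
    "('a, 'c) cell_complex \<Rightarrow> nat \<Rightarrow> ('c \<Rightarrow> 'w \<Rightarrow> real) \<Rightarrow> 'w \<Rightarrow> real \<Rightarrow> ('a, 'c) cell_complex" where
  "bernoulli_process X l t \<omega> s = add_cells X l {\<sigma> \<in> cells X l. t \<sigma> \<omega> \<le> s}"

end

theory Submission
  imports Defs
begin

text \<open>
  The weight of \<open>F\<close> in \<open>T\<^sub>l(X; 1/t, 1/(1-t))\<close> is \<open>((1-t)/t)\<^bsup>z-r(F)\<^esup> (t/(1-t))\<^bsup>|F|-r(F)\<^esup>\<close>, where \<open>z\<close> is the dimension
  of the reduced \<open>(l-1)\<close>-cycles and \<open>r(F)\<close> the rank of the boundaries of the cells in \<open>F\<close>. The rank cancels,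
  and up to a factor independent of \<open>F\<close> the weight is \<open>t\<^bsup>|F|\<^esup>(1-t)\<^bsup>n-|F|\<^esup>\<close>, the probability that \<open>F\<close> is the set of
  cells present at time \<open>t\<close>. So the integrand is the expected Betti number at time \<open>t\<close>, and the
  lifetime sum is the integral of the Betti number.

  That the ranks behave in this way needs that boundaries are cycles. Each cell class spans
  an infinite cyclic group relative to the complement of the cell (excision), so the cellular chain
  groups are free on the cells and the incidence numbers compose to zero.
\<close>

section \<open>The closed disc\<close>

text \<open>\<open>incidence\<close> is picked by \<open>SOME\<close> from the expansions of a
  boundary in the cell classes, so nothing is known about it until such expansions are shown to
  exist; uniqueness is then what turns the vanishing of a double boundary into the vanishing of
  integer sums. The incidence numbers of X_F are picked anew in another complex, and have to be
  identified with those of X before the ranks for different F can be compared inside one space of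
  chains.

  That boundaries are cycles gives r(F) \<le> z. Without it the truncated subtraction in
  \<open>reduced_betti\<close> would spoil the cancellation of the ranks, and a basis of boundaries
  could not be extended to one of the cycles.

  \<open>lifetime_sum\<close> is a definite description: some barcode must be exhibited, and all
  barcodes must have the same total lifetime. The latter holds because the number of bars alive at a
  time is the Betti number at that time. All cells below dimension l are present from the start, so
  every bar can be born at time 0, and a greedy choice of boundaries in the order of their times
  determines the deaths.\<close>

lemma topspace_unit_disc: "topspace (unit_disc k) = {x. (\<forall>i\<ge>k. x i = 0) \<and> (\<Sum>i<k. (x i)\<^sup>2) \<le> 1}"
  by (auto simp: unit_disc_def topspace_Euclidean_space)

lemma unit_disc_eq: "unit_disc k = top_of_set {x. (\<forall>i\<ge>k. x i = 0) \<and> (\<Sum>i<k. (x i)\<^sup>2) \<le> 1}"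
  by (simp add: unit_disc_def Euclidean_space_def subtopology_subtopology euclidean_product_topology
      Collect_conj_eq)

lemma disc_partition:
  "topspace (unit_disc k) = open_disc k \<union> disc_boundary k" "open_disc k \<inter> disc_boundary k = {}"
  by (auto simp: open_disc_def disc_boundary_def topspace_unit_disc)

lemma zero_in_open_disc: "(\<lambda>_. 0) \<in> open_disc k"
  by (simp add: open_disc_def topspace_unit_disc)

lemma continuous_on_disc_norm: "continuous_on S (\<lambda>x::nat \<Rightarrow> real. \<Sum>i<k. (x i)\<^sup>2)"
  by (intro continuous_intros continuous_on_subset[OF continuous_on_product_coordinates]) auto

lemma closedin_disc_boundary: "closedin (unit_disc k) (disc_boundary k)"
proof -
  have "continuous_map (unit_disc k) euclideanreal (\<lambda>x. \<Sum>i<k. (x i)\<^sup>2)"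
    unfolding unit_disc_eq by (simp add: continuous_on_disc_norm)
  then have "closedin (unit_disc k) {x \<in> topspace (unit_disc k). (\<Sum>i<k. (x i)\<^sup>2) \<in> {1}}"
    by (rule closedin_continuous_map_preimage) simp
  then show ?thesis by (simp add: disc_boundary_def)
qed

lemma closed_coordinate_zero: "closed {x::nat\<Rightarrow>real. x i = 0}"
  using continuous_on_product_coordinates[of i] by (intro closed_Collect_eq) auto

lemma closed_disc_set: "closed {x::nat\<Rightarrow>real. (\<forall>i\<ge>k. x i = 0) \<and> (\<Sum>i<k. (x i)\<^sup>2) \<le> 1}"
proof -
  have c1: "closed (\<Inter>i\<in>{k..}. {x::nat\<Rightarrow>real. x i = 0})"
    using closed_coordinate_zero by blast
  have c2: "closed {x::nat\<Rightarrow>real. (\<Sum>i<k. (x i)\<^sup>2) \<le> 1}"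
    by (intro closed_Collect_le continuous_on_disc_norm continuous_on_const)
  have eq: "{x::nat\<Rightarrow>real. (\<forall>i\<ge>k. x i = 0) \<and> (\<Sum>i<k. (x i)\<^sup>2) \<le> 1}
      = (\<Inter>i\<in>{k..}. {x. x i = 0}) \<inter> {x. (\<Sum>i<k. (x i)\<^sup>2) \<le> 1}" by auto
  show ?thesis unfolding eq using c1 c2 by (rule closed_Int)
qed

lemma disc_coordinate_bound:
  fixes x :: "nat \<Rightarrow> real"
  assumes "\<forall>i\<ge>k. x i = 0" "(\<Sum>i<k. (x i)\<^sup>2) \<le> 1"
  shows "x i \<in> {-1..1}"
proof -
  have "(x i)\<^sup>2 \<le> 1"
  proof (cases "i < k")
    case True
    then have "(x i)\<^sup>2 \<le> (\<Sum>i<k. (x i)\<^sup>2)" by (intro member_le_sum) auto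
    with assms show ?thesis by linarith
  next
    case False
    then have "x i = 0" using assms(1) by simp
    then show ?thesis by simp
  qed
  then have "\<bar>x i\<bar> \<le> 1" by (simp only: abs_square_le_1)
  then show ?thesis by auto
qed

text \<open>Points of the disc are infinite sequences, so Tychonoff takes the place of Heine-Borel:
  the disc is closed in the product of countably many intervals [-1, 1].\<close>

lemma compact_space_unit_disc: "compact_space (unit_disc k)"
proof -
  let ?S = "{x::nat\<Rightarrow>real. (\<forall>i\<ge>k. x i = 0) \<and> (\<Sum>i<k. (x i)\<^sup>2) \<le> 1}"
  have "compactin (powertop_real UNIV) (PiE UNIV (\<lambda>i::nat. {-1..1}))"
    unfolding compactin_PiE by (intro disjI2 ballI) (simp only: compactin_euclidean_iff compact_Icc)
  then have co: "compact (PiE UNIV (\<lambda>i::nat. {-1..1::real}))"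
    by (simp only: euclidean_product_topology compactin_euclidean_iff)
  have "?S \<subseteq> PiE UNIV (\<lambda>i::nat. {-1..1})"
    using disc_coordinate_bound by (intro subsetI PiE_I) auto
  then have "?S = PiE UNIV (\<lambda>i::nat. {-1..1}) \<inter> ?S" by (simp only: Int_absorb1)
  then have "compact ?S" using compact_Int_closed[OF co closed_disc_set[of k]] by (simp only:)
  then show ?thesis
    unfolding unit_disc_eq by (intro compact_space_subtopology) (simp only: compactin_euclidean_iff)
qed

lemma Hausdorff_space_unit_disc: "Hausdorff_space (unit_disc k)"
  by (simp add: unit_disc_def Hausdorff_Euclidean_space Hausdorff_space_subtopology)

lemma continuous_on_coord_snd: "continuous_on S (\<lambda>z::'b::topological_space \<times> (nat \<Rightarrow> real). snd z i)"
  using continuous_on_compose[of S snd "\<lambda>u. u i"]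
  by (simp add: o_def continuous_on_snd continuous_on_subset[OF continuous_on_product_coordinates])

lemma sum_square_scale: "(\<Sum>i<k. (c * x i)\<^sup>2) = c\<^sup>2 * (\<Sum>i<k. (x i :: real)\<^sup>2)"
  by (simp add: power_mult_distrib sum_distrib_left)

text \<open>Straight-line contraction to the origin. It reduces the homology of the disc relative to
  its boundary to the reduced homology of the sphere.\<close>

lemma contractible_unit_disc: "contractible_space (unit_disc k)"
proof -
  let ?S = "{x::nat\<Rightarrow>real. (\<forall>i\<ge>k. x i = 0) \<and> (\<Sum>i<k. (x i)\<^sup>2) \<le> 1}"
  let ?h = "\<lambda>z i. (1 - fst z) * snd z i :: real"
  have "continuous_on ({0..1} \<times> ?S) ?h"
    by (intro continuous_on_coordinatewise_then_product continuous_intros continuous_on_coord_snd)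
  moreover have "?h ` ({0..1} \<times> ?S) \<subseteq> ?S"
  proof clarsimp
    fix t :: real and x :: "nat \<Rightarrow> real"
    assume t: "0 \<le> t" "t \<le> 1" and x: "(\<Sum>i<k. (x i)\<^sup>2) \<le> 1"
    have "(1-t)\<^sup>2 * (\<Sum>i<k. (x i)\<^sup>2) \<le> 1 * 1"
      using t x by (intro mult_mono) (auto simp: power_le_one sum_nonneg)
    then show "(\<Sum>i<k. ((1 - t) * x i)\<^sup>2) \<le> 1" by (simp add: sum_square_scale)
  qed
  ultimately have "homotopic_with (\<lambda>x. True) (top_of_set ?S) (top_of_set ?S) id (\<lambda>x. (\<lambda>i. 0))"
    unfolding homotopic_with_def
    by (intro exI[of _ ?h]) (auto simp: Pi_iff fun_eq_iff image_subset_iff prod_topology_subtopology_eu)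
  then show ?thesis
    unfolding contractible_space_def unit_disc_eq by blast
qed

text \<open>Time \<open>1\<close> is the identity, time \<open>0\<close> the projection to the boundary sphere.\<close>

definition radial :: "nat \<Rightarrow> real \<times> (nat \<Rightarrow> real) \<Rightarrow> nat \<Rightarrow> real" where
  "radial k z = (\<lambda>i. (fst z + (1 - fst z) / sqrt (\<Sum>j<k. (snd z j)\<^sup>2)) * snd z i)"

text \<open>Each point moves along its own ray, and its radius is a convex combination of 1 and the
  original radius. The origin is excluded because of the division by the radius.\<close>

lemma radial_norm:
  assumes "(\<Sum>i<k. (u i)\<^sup>2) > (0::real)"
  shows "(\<Sum>i<k. (radial k (t, u) i)\<^sup>2) = (t * sqrt (\<Sum>i<k. (u i)\<^sup>2) + (1 - t))\<^sup>2"
proof -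
  let ?r = "sqrt (\<Sum>i<k. (u i)\<^sup>2)"
  have r: "?r > 0" "(\<Sum>i<k. (u i)\<^sup>2) = ?r\<^sup>2" using assms by auto
  have "(\<Sum>i<k. (radial k (t, u) i)\<^sup>2) = (t + (1 - t) / ?r)\<^sup>2 * ?r\<^sup>2"
    unfolding radial_def fst_conv snd_conv sum_square_scale using assms by simp
  also have "\<dots> = ((t + (1 - t) / ?r) * ?r)\<^sup>2" by (simp only: power_mult_distrib)
  also have "(t + (1 - t) / ?r) * ?r = t * ?r + (1 - t)" using r(1) by (simp add: field_simps)
  finally show ?thesis .
qed

lemma punctured_disc_pos:
  assumes "u \<in> topspace (unit_disc k) - {\<lambda>_. 0}" shows "(\<Sum>i<k. (u i)\<^sup>2) > 0"
proof (rule ccontr)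
  assume "\<not> ?thesis"
  then have "(\<Sum>i<k. (u i)\<^sup>2) = 0" by (metis sum_nonneg zero_le_power2 not_less antisym)
  then have "\<forall>i<k. u i = 0" by (simp add: sum_nonneg_eq_0_iff)
  then have "u = (\<lambda>_. 0)" using assms by (auto simp: topspace_unit_disc fun_eq_iff not_less) (metis not_le)
  then show False using assms by auto
qed

lemma radial_in_punctured_disc:
  assumes "t \<in> {0..1}" "u \<in> topspace (unit_disc k) - {\<lambda>_. 0}"
  shows "radial k (t, u) \<in> topspace (unit_disc k) - {\<lambda>_. 0}"
proof -
  let ?r = "sqrt (\<Sum>i<k. (u i)\<^sup>2)"
  have r: "?r > 0" "?r \<le> 1" using punctured_disc_pos[OF assms(2)] assms(2) by (auto simp: topspace_unit_disc)
  have "t * ?r + (1 - t) > 0"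
  proof (cases "t = 0")
    case False
    then have "t * ?r > 0" using r assms by auto
    then show ?thesis using assms by auto
  qed simp
  moreover have "t * ?r \<le> t * 1" using r(2) assms(1) by (intro mult_left_mono) auto
  then have "t * ?r + (1 - t) \<le> 1" by simp
  ultimately have "(\<Sum>i<k. (radial k (t, u) i)\<^sup>2) \<le> 1" "(\<Sum>i<k. (radial k (t, u) i)\<^sup>2) > 0"
    unfolding radial_norm[OF punctured_disc_pos[OF assms(2)]] by (auto simp: abs_square_le_1)
  moreover have "\<forall>i\<ge>k. radial k (t, u) i = 0" using assms(2) by (simp add: radial_def topspace_unit_disc)
  ultimately show ?thesis by (auto simp: topspace_unit_disc)
qed

lemma radial_1: "radial k (1, u) = u"
  by (simp add: radial_def)

lemma radial_0: "u \<in> topspace (unit_disc k) - {\<lambda>_. 0} \<Longrightarrow> radial k (0, u) \<in> disc_boundary k"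
  using radial_in_punctured_disc[of 0 u k] punctured_disc_pos[of u k]
  by (simp add: disc_boundary_def radial_norm)

text \<open>The homotopy is stationary on the sphere. This makes it compatible with whatever
  identifications a characteristic map makes there.\<close>

lemma radial_boundary: "u \<in> disc_boundary k \<Longrightarrow> radial k (t, u) = u"
  by (simp add: radial_def disc_boundary_def)

lemma continuous_map_radial:
  "continuous_map (prod_topology (top_of_set {0..1}) (subtopology (unit_disc k) (topspace (unit_disc k) - {\<lambda>_. 0})))
     (subtopology (unit_disc k) (topspace (unit_disc k) - {\<lambda>_. 0})) (radial k)"
proof -
  let ?S = "topspace (unit_disc k) - {\<lambda>_. 0}"
  have eq: "subtopology (unit_disc k) ?S = top_of_set ?S"
    by (simp add: unit_disc_eq subtopology_subtopology) (intro arg_cong[where f=top_of_set] Int_absorb1 Diff_subset)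
  have "continuous_on ({0..1} \<times> ?S) (radial k)"
    unfolding radial_def
    by (intro continuous_on_coordinatewise_then_product continuous_intros continuous_on_coord_snd)
      (use punctured_disc_pos in fastforce)
  then show ?thesis
    unfolding eq prod_topology_subtopology_eu using radial_in_punctured_disc
    by (auto simp: Pi_iff)
qed


section \<open>Attaching a cell\<close>

lemma subtopology_disc_boundary_Suc: "subtopology (unit_disc (Suc n)) (disc_boundary (Suc n)) = nsphere n"
proof -
  have "{x. (\<Sum>i<Suc n. (x i)\<^sup>2) \<le> 1} \<inter> disc_boundary (Suc n)
      = topspace (Euclidean_space (Suc n)) \<inter> {x. (\<Sum>i\<le>n. (x i)\<^sup>2) = 1}"
    by (auto simp: disc_boundary_def topspace_unit_disc topspace_Euclidean_space lessThan_Suc_atMost)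
  then show ?thesis
    unfolding nsphere_def unit_disc_def subtopology_subtopology by (simp add: subtopology_restrict)
qed

lemma disc_boundary_0: "disc_boundary 0 = {}"
  by (simp add: disc_boundary_def)

lemma topspace_unit_disc_0: "topspace (unit_disc 0) = {\<lambda>_. 0}"
  by (auto simp: topspace_unit_disc)

abbreviation disc_homology :: "nat \<Rightarrow> (nat \<Rightarrow> real) chain set monoid" where
  "disc_homology k \<equiv> relative_homology_group (int k) (unit_disc k) (disc_boundary k)"

text \<open>The exact sequence of the pair lowers the degree by one and leaves the reduced homology
  of a sphere. In dimension 0 the boundary is empty and the disc is a point, so the coefficient
  group appears directly.\<close>

lemma disc_homology_iso_int: "disc_homology k \<cong> integer_group"
proof (cases k)
  case 0
  then show ?thesis using homology_coefficients[OF topspace_unit_disc_0] by (simp add: disc_boundary_0)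
next
  case (Suc n)
  \<comment> \<open>The first unit vector shows that the boundary sphere is nonempty, as the
    comparison with reduced homology requires.\<close>
  have "(\<lambda>i. if i = 0 then 1 else 0) \<in> topspace (unit_disc (Suc n)) \<inter> disc_boundary (Suc n)"
    using in_topspace_nsphere[of n] by (simp flip: subtopology_disc_boundary_Suc)
  then have "relative_homology_group (int (Suc n)) (unit_disc (Suc n)) (disc_boundary (Suc n)) \<cong>
      reduced_homology_group (int (Suc n) - 1) (nsphere n)"
    unfolding subtopology_disc_boundary_Suc[symmetric]
    by (intro isomorphic_group_relative_homology_of_contractible contractible_unit_disc) blast
  also have "reduced_homology_group (int (Suc n) - 1) (nsphere n) \<cong> integer_group"
    using reduced_homology_group_nsphere(1)[of n] by simp
  finally (iso_trans) show ?thesis using Suc by simp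
qed

lemma disc_class_generates:
  "disc_class k \<in> carrier (disc_homology k)"
  "generate (disc_homology k) {disc_class k} = carrier (disc_homology k)"
proof -
  have "cyclic_group (disc_homology k)"
    using isomorphic_group_cyclicity[OF disc_homology_iso_int] cyclic_integer_group by simp
  then obtain a where "a \<in> carrier (disc_homology k)" "subgroup_generated (disc_homology k) {a} = disc_homology k"
    by (auto simp: cyclic_group_def)
  then have "\<exists>a. a \<in> carrier (disc_homology k) \<and> generate (disc_homology k) {a} = carrier (disc_homology k)"
    by (metis carrier_subgroup_generated Int_insert_right_if1 Int_empty_right)
  then show "disc_class k \<in> carrier (disc_homology k)"
    "generate (disc_homology k) {disc_class k} = carrier (disc_homology k)"
    unfolding disc_class_def by (metis (mono_tags, lifting) someI_ex)+
qed

lemma disc_homology_element: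
  assumes "x \<in> carrier (disc_homology k)"
  obtains n :: int where "x = disc_class k [^]\<^bsub>disc_homology k\<^esub> n"
proof -
  have "x \<in> generate (disc_homology k) {disc_class k}" using assms disc_class_generates(2) by simp
  then show thesis
    using group.generate_pow[OF group_relative_homology_group disc_class_generates(1)] that by blast
qed

text \<open>A generator of an infinite cyclic group has infinite order. Every later proof that an
  integer coefficient vanishes rests on this fact.\<close>

lemma disc_class_infinite_order:
  assumes "disc_class k [^]\<^bsub>disc_homology k\<^esub> (n::int) = \<one>\<^bsub>disc_homology k\<^esub>"
  shows "n = 0"
proof -
  have "infinite (carrier (disc_homology k))"
    using iso_finite[OF disc_homology_iso_int] by simp
  moreover have "subgroup_generated (disc_homology k) {disc_class k} = disc_homology k"
    using disc_class_generates[of k] by (simp add: subgroup_generated_def)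
  ultimately have "infinite (carrier (subgroup_generated (disc_homology k) {disc_class k}))" by simp
  then have inj: "disc_class k [^]\<^bsub>disc_homology k\<^esub> i = disc_class k [^]\<^bsub>disc_homology k\<^esub> j \<Longrightarrow> i = j" for i j :: int
    by (simp only: group.infinite_cyclic_subgroup_int[OF group_relative_homology_group disc_class_generates(1)])
  show ?thesis by (rule inj) (simp add: assms)
qed

text \<open>The base \<open>A\<close> need not be a skeleton: cells are attached one after the
  other, so \<open>A\<close> may contain other cells of the same dimension. The disc over its
  boundary is a further instance, which lets the same lemmas be applied on both sides of a
  comparison.\<close>

locale cell_attachment =
  fixes k :: nat and Y :: "'a topology" and A :: "'a set" and \<phi> :: "(nat \<Rightarrow> real) \<Rightarrow> 'a"
  assumes Hausdorff: "Hausdorff_space Y"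
    and closed_base: "closedin Y A"
    and continuous_char: "continuous_map (unit_disc k) Y \<phi>"
    and inj_char: "inj_on \<phi> (open_disc k)"
    and char_boundary: "\<phi> ` disc_boundary k \<subseteq> A"
    and cell_disjoint: "A \<inter> \<phi> ` open_disc k = {}"
    and topspace_eq: "topspace Y = A \<union> \<phi> ` open_disc k"
begin

abbreviation (input) centre :: "nat \<Rightarrow> real" where "centre \<equiv> \<lambda>_. 0"
abbreviation "punctured_disc \<equiv> topspace (unit_disc k) - {centre}"
abbreviation "punctured \<equiv> topspace Y - {\<phi> centre}"

lemma char_cases:
  assumes "u \<in> topspace (unit_disc k)"
  shows "u \<in> open_disc k \<and> \<phi> u \<notin> A \<or> u \<in> disc_boundary k \<and> \<phi> u \<in> A"
  using assms disc_partition[of k] char_boundary cell_disjoint by blast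

lemma char_in_topspace: "u \<in> topspace (unit_disc k) \<Longrightarrow> \<phi> u \<in> topspace Y"
  using continuous_char by (auto simp: continuous_map_def)

lemma base_subset: "A \<subseteq> punctured"
  using cell_disjoint zero_in_open_disc[of k] topspace_eq by blast

lemma char_eq_centre: "u \<in> topspace (unit_disc k) \<Longrightarrow> \<phi> u = \<phi> centre \<longleftrightarrow> u = centre"
  using char_cases[of u] cell_disjoint zero_in_open_disc[of k] inj_char by (auto dest: inj_onD)

lemma proper_char: "proper_map (unit_disc k) Y \<phi>"
  by (intro continuous_imp_proper_map compact_space_unit_disc Hausdorff_imp_kc_space Hausdorff continuous_char)

text \<open>The radial homotopy descends from the disc, since the product of the characteristic map with the
  unit interval is proper and hence a quotient map.\<close>

lemma deformation_base:
  obtains r where "continuous_map (subtopology Y punctured) (subtopology (subtopology Y punctured) A) r"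
    "homotopic_with (\<lambda>h. h ` A \<subseteq> A) (subtopology Y punctured) (subtopology Y punctured) r id"
proof -
  let ?I = "top_of_set {0..1::real}" and ?D = "subtopology (unit_disc k) punctured_disc"
    and ?Z = "subtopology Y punctured"
  define B where "B = \<phi> ` punctured_disc"
  \<comment> \<open>The preimage is taken in the open disc, where the characteristic map is
    injective. The formula \<open>h_\<phi>\<close> below also covers boundary points, because
    \<open>radial\<close> fixes them.\<close>
  define h where "h = (\<lambda>(t, x). if x \<in> A then x else \<phi> (radial k (t, inv_into (open_disc k) \<phi> x)))"
  define q where "q = (\<lambda>(t::real, u). (t, \<phi> u))"
  let ?ZB = "subtopology Y B"
  have B: "B \<subseteq> punctured"
    unfolding B_def using char_in_topspace char_eq_centre by (intro image_subsetI) simp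
  have cover: "punctured = A \<union> B"
    using topspace_eq base_subset B disc_partition(1)[of k] unfolding B_def by blast
  have h_\<phi>: "h (t, \<phi> u) = \<phi> (radial k (t, u))" if "u \<in> punctured_disc" for t u
  proof (cases "\<phi> u \<in> A")
    case True
    then have "u \<in> disc_boundary k" using char_cases that by blast
    then show ?thesis using True by (simp add: h_def radial_boundary)
  next
    case False
    then have "u \<in> open_disc k" using char_cases that by blast
    then show ?thesis using False by (simp add: h_def inv_into_f_f[OF inj_char])
  qed
  \<comment> \<open>The punctured disc is a full preimage, so that properness survives the
    restriction.\<close>
  have restr: "{u \<in> topspace (unit_disc k). \<phi> u \<in> B} = punctured_disc"
    using B char_eq_centre by (auto simp: B_def)
  have "proper_map ?D ?ZB \<phi>"
    using proper_map_restriction[OF proper_char restr] .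
  then have "proper_map (prod_topology ?I ?D) (prod_topology ?I ?ZB) q"
    unfolding q_def using proper_map_prod[of ?I ?D ?I ?ZB id \<phi>] by (simp add: proper_map_id)
  then have "closed_map (prod_topology ?I ?D) (prod_topology ?I ?ZB) q"
    by (rule proper_imp_closed_map)
  moreover have cont\<phi>: "continuous_map ?D ?ZB \<phi>"
    using continuous_char restr by (auto simp: continuous_map_in_subtopology continuous_map_from_subtopology)
  have "continuous_map (prod_topology ?I ?D) (prod_topology ?I ?ZB) q"
    unfolding q_def using cont\<phi> by (simp add: continuous_map_prod_top)
  moreover have "q ` topspace (prod_topology ?I ?D) = topspace (prod_topology ?I ?ZB)"
    using B char_in_topspace by (auto simp: q_def B_def image_iff)
  ultimately have quot: "quotient_map (prod_topology ?I ?D) (prod_topology ?I ?ZB) q"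
    by (intro continuous_closed_imp_quotient_map)
  have cont\<phi>Z: "continuous_map ?D ?Z \<phi>"
    using cont\<phi> B by (auto simp: continuous_map_in_subtopology)
  have "continuous_map (prod_topology ?I ?D) ?Z (\<phi> \<circ> radial k)"
    using continuous_map_compose[OF continuous_map_radial cont\<phi>Z] .
  then have "continuous_map (prod_topology ?I ?D) ?Z (h \<circ> q)"
  proof (rule continuous_map_eq)
    fix z assume "z \<in> topspace (prod_topology ?I ?D)"
    then have "snd z \<in> punctured_disc" by auto
    then show "(\<phi> \<circ> radial k) z = (h \<circ> q) z"
      using h_\<phi>[of "snd z" "fst z"] by (simp add: q_def case_prod_beta)
  qed
  then have contB: "continuous_map (prod_topology ?I ?ZB) ?Z h"
    using continuous_compose_quotient_map[OF quot] by blast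
  have "continuous_map (prod_topology ?I (subtopology Y A)) ?Z snd"
    using base_subset continuous_map_snd[of ?I "subtopology Y A"] by (auto simp: continuous_map_in_subtopology)
  then have contA: "continuous_map (prod_topology ?I (subtopology Y A)) ?Z h"
    by (rule continuous_map_eq) (auto simp: h_def)
  have clB: "closedin ?Z B"
  proof -
    have "closedin Y (\<phi> ` topspace (unit_disc k))"
      using proper_imp_closed_map[OF proper_char] by (auto simp: closed_map_def)
    moreover have "B = \<phi> ` topspace (unit_disc k) \<inter> punctured"
      using B char_eq_centre by (auto simp: B_def)
    ultimately show ?thesis by (auto simp: closedin_subtopology)
  qed
  have clA: "closedin ?Z A"
    using closed_base base_subset by (auto simp: closedin_subtopology)
  let ?P = "prod_topology ?I ?Z"
  have sub: "subtopology ?P ({0..1} \<times> C) = prod_topology ?I (subtopology Y C)" if "C \<subseteq> punctured" for C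
  proof -
    have "topspace Y \<inter> punctured \<inter> C = C" "topspace Y \<inter> C = C" using that by blast+
    then show ?thesis
      by (simp only: prod_topology_subtopology subtopology_subtopology Times_Int_Times topspace_euclidean
          topspace_euclidean_subtopology topspace_prod_topology Int_UNIV_left Int_UNIV_right Int_absorb)
  qed
  have cont: "continuous_map ?P ?Z h"
  proof (rule pasting_lemma_closed[where I="{A, B}" and T="\<lambda>C. {0..1} \<times> C" and f="\<lambda>_. h"])
    show "closedin ?P ({0..1} \<times> C)" if "C \<in> {A, B}" for C
      using that clA clB by (auto simp: closedin_prod_Times_iff)
    show "continuous_map (subtopology ?P ({0..1} \<times> C)) ?Z h" if "C \<in> {A, B}" for C
      using that contA contB sub[OF base_subset] sub[OF B] by auto
  qed (use cover in auto)
  have hA: "h (t, x) = x" if "x \<in> A" for t x using that by (simp add: h_def)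
  have h0: "h (0, x) \<in> A" and h1: "h (1, x) = x" if x: "x \<in> punctured" for x
  proof -
    consider "x \<in> A" | u where "u \<in> punctured_disc" "x = \<phi> u" using cover x by (auto simp: B_def)
    then have "h (0, x) \<in> A \<and> h (1, x) = x"
      using char_boundary radial_0[of _ k] by cases (auto simp: hA h_\<phi> radial_1)
    then show "h (0, x) \<in> A" "h (1, x) = x" by auto
  qed
  have hom: "homotopic_with (\<lambda>h. h ` A \<subseteq> A) ?Z ?Z (\<lambda>x. h (0, x)) id"
    unfolding homotopic_with_def
  \<comment> \<open>\<open>homotopic_with_def\<close> asks for the end conditions at all points of
    the type. The modification outside the punctured space serves the condition at time 1 and does
    not affect continuity, which concerns the topspace alone.\<close>
  proof (intro exI[of _ "\<lambda>z. if snd z \<in> punctured then h z else (if fst z = 1 then snd z else h z)"] conjI)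
  qed (use cont in \<open>auto simp: hA h1 image_subset_iff elim!: continuous_map_eq\<close>)
  show thesis
  proof (rule that[OF _ hom])
    show "continuous_map ?Z (subtopology ?Z A) (\<lambda>x. h (0, x))"
      using homotopic_with_imp_continuous_maps[OF hom] h0 by (auto simp: continuous_map_in_subtopology)
  qed
qed

text \<open>\<open>A\<close> is a deformation retract of the punctured space, so the homology of
  that pair is trivial in all degrees, and the exact sequence of the triple leaves an
  isomorphism.\<close>

lemma iso_relativization:
  "hom_induced p Y A Y punctured id \<in> iso (relative_homology_group p Y A) (relative_homology_group p Y punctured)"
proof -
  obtain r where r: "continuous_map (subtopology Y punctured) (subtopology (subtopology Y punctured) A) r"
    "homotopic_with (\<lambda>h. h ` A \<subseteq> A) (subtopology Y punctured) (subtopology Y punctured) r id"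
    by (rule deformation_base)
  have triv: "trivial_group (relative_homology_group q (subtopology Y punctured) A)" for q
    using trivial_relative_homology_group_alt[OF r] .
  have "exact_seq
         ([relative_homology_group (p - 1) (subtopology Y punctured) A, relative_homology_group p Y punctured,
           relative_homology_group p Y A, relative_homology_group p (subtopology Y punctured) A],
          [hom_relboundary p Y punctured A, hom_induced p Y A Y punctured id, hom_induced p (subtopology Y punctured) A Y A id])"
    using homology_exactness_triple_1[OF base_subset] homology_exactness_triple_3[OF base_subset]
    by fastforce
  then show ?thesis by (rule very_short_exact_sequence[OF _ triv triv])
qed

text \<open>The excised set is the base: it is closed and contained in the punctured space, which is
  open because points are closed in a Hausdorff space.\<close>

lemma iso_excision:
  "hom_induced p (subtopology Y (topspace Y - A)) (punctured - A) Y punctured id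
   \<in> iso (relative_homology_group p (subtopology Y (topspace Y - A)) (punctured - A)) (relative_homology_group p Y punctured)"
proof -
  have "openin Y punctured"
    using Hausdorff char_in_topspace zero_in_open_disc[of k] disc_partition(1)[of k]
    by (intro openin_diff openin_topspace) (auto simp: closedin_Hausdorff_singleton)
  then have "Y closure_of A \<subseteq> Y interior_of punctured"
    using closed_base base_subset by (simp add: closure_of_closedin interior_of_openin)
  from homology_excision_axiom[OF this, of "topspace Y" p] show ?thesis by simp
qed

end

text \<open>The disc arises from its boundary by attaching its own interior. Both isomorphisms above
  therefore hold for it as well.\<close>

lemma disc_cell_attachment: "cell_attachment k (unit_disc k) (disc_boundary k) id"
  using disc_partition[of k]
  by unfold_locales (auto simp: Hausdorff_space_unit_disc closedin_disc_boundary)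

text \<open>Two out of three for isomorphisms, for use along the commuting squares of
  \<open>iso_char\<close>.\<close>

lemma iso_cancel_right:
  "f \<in> iso G H \<Longrightarrow> g \<in> hom H K \<Longrightarrow> g \<circ> f \<in> iso G K \<Longrightarrow> g \<in> iso H K"
  by (simp add: iso_def bij_betw_comp_iff[of f "carrier G" "carrier H"])

lemma iso_cancel_left:
  "g \<in> iso H K \<Longrightarrow> f \<in> hom G H \<Longrightarrow> g \<circ> f \<in> iso G K \<Longrightarrow> f \<in> iso G H"
  using bij_betw_comp_iff2[of g "carrier H" "carrier K" f "carrier G"]
  by (auto simp: iso_def hom_def Pi_iff image_subset_iff)

context cell_attachment begin

text \<open>The open disc is the full preimage of the open cell, so the restriction is still proper
  and hence closed; a continuous closed bijection is a homeomorphism.\<close>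

lemma homeomorphic_open_cell:
  "homeomorphic_map (subtopology (unit_disc k) (topspace (unit_disc k) - disc_boundary k))
     (subtopology Y (topspace Y - A)) \<phi>"
proof -
  have D: "topspace (unit_disc k) - disc_boundary k = open_disc k" using disc_partition[of k] by blast
  have restr: "{u \<in> topspace (unit_disc k). \<phi> u \<in> topspace Y - A} = open_disc k"
    using char_cases char_in_topspace disc_partition[of k] by blast
  have "proper_map (subtopology (unit_disc k) (open_disc k)) (subtopology Y (topspace Y - A)) \<phi>"
    using proper_map_restriction[OF proper_char restr] .
  moreover have "continuous_map (subtopology (unit_disc k) (open_disc k)) (subtopology Y (topspace Y - A)) \<phi>"
    using continuous_char restr by (auto simp: continuous_map_in_subtopology continuous_map_from_subtopology)
  moreover have "topspace (subtopology (unit_disc k) (open_disc k)) = open_disc k"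
    using disc_partition(1)[of k] by auto
  ultimately show ?thesis unfolding D using inj_char cell_disjoint topspace_eq
    by (intro bijective_closed_imp_homeomorphic_map proper_imp_closed_map) auto
qed

text \<open>Both pairs are compared with the pairs relative to the complement of the centre, where excision
  leaves only the open cell.\<close>

lemma iso_char:
  "hom_induced p (unit_disc k) (disc_boundary k) Y A \<phi>
   \<in> iso (relative_homology_group p (unit_disc k) (disc_boundary k)) (relative_homology_group p Y A)"
proof -
  interpret D: cell_attachment k "unit_disc k" "disc_boundary k" id by (rule disc_cell_attachment)
  let ?D = "unit_disc k"
  let ?Do = "subtopology ?D (topspace ?D - disc_boundary k)" and ?Yo = "subtopology Y (topspace Y - A)"
  let ?pD = "D.punctured - disc_boundary k" and ?pY = "punctured - A"
  have im: "\<phi> ` ?pD = ?pY"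
  proof
    show "\<phi> ` ?pD \<subseteq> ?pY"
    proof (rule image_subsetI)
      fix u assume "u \<in> ?pD"
      then show "\<phi> u \<in> ?pY" using char_cases[of u] char_in_topspace[of u] char_eq_centre[of u] by auto
    qed
    show "?pY \<subseteq> \<phi> ` ?pD"
    proof
      fix y assume y: "y \<in> ?pY"
      then obtain u where u: "u \<in> open_disc k" "y = \<phi> u" using topspace_eq by blast
      moreover have "u \<noteq> centre" using y u(2) by auto
      moreover have "u \<in> topspace (unit_disc k)" "u \<notin> disc_boundary k"
        using u(1) disc_partition[of k] by auto
      ultimately have "u \<in> ?pD" by simp
      with u show "y \<in> \<phi> ` ?pD" by blast
    qed
  qed
  have iso1: "hom_induced p ?Do ?pD ?Yo ?pY \<phi> \<in> iso (relative_homology_group p ?Do ?pD) (relative_homology_group p ?Yo ?pY)"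
    by (intro homeomorphic_map_relative_homology_iso homeomorphic_open_cell im) auto
  have c1: "continuous_map ?D Y \<phi>" by (rule continuous_char)
  have f2: "\<phi> \<in> D.punctured \<rightarrow> punctured"
    using char_in_topspace char_eq_centre by (intro funcsetI) simp
  have c2: "continuous_map ?Do ?Yo \<phi>" using homeomorphic_open_cell homeomorphic_imp_continuous_map by blast
  have sq1: "hom_induced p ?Yo ?pY Y punctured id \<circ> hom_induced p ?Do ?pD ?Yo ?pY \<phi>
     = hom_induced p ?D D.punctured Y punctured \<phi> \<circ> hom_induced p ?Do ?pD ?D D.punctured id"
    using im f2 c1 c2 by (subst (1 2) hom_induced_compose[symmetric]) auto
  have sq2: "hom_induced p Y A Y punctured id \<circ> hom_induced p ?D (disc_boundary k) Y A \<phi>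
     = hom_induced p ?D D.punctured Y punctured \<phi> \<circ> hom_induced p ?D (disc_boundary k) ?D D.punctured id"
    using f2 c1 base_subset D.base_subset char_boundary by (subst (1 2) hom_induced_compose[symmetric]) auto
  \<comment> \<open>This map between the pairs relative to the punctured spaces is shared by both
    squares. The excision square proves it an isomorphism, and the relativization square transfers
    this to the characteristic map.\<close>
  let ?M = "hom_induced p ?D D.punctured Y punctured \<phi>"
  have "?M \<circ> hom_induced p ?Do ?pD ?D D.punctured id
      \<in> iso (relative_homology_group p ?Do ?pD) (relative_homology_group p Y punctured)"
    unfolding sq1[symmetric] by (rule iso_set_trans[OF iso1 iso_excision])
  then have "?M \<in> iso (relative_homology_group p ?D D.punctured) (relative_homology_group p Y punctured)"
    using iso_cancel_right[OF D.iso_excision hom_induced_hom] by blast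
  from iso_set_trans[OF D.iso_relativization this] show ?thesis
    unfolding sq2[symmetric] by (intro iso_cancel_left[OF iso_relativization hom_induced_hom])
qed

end


section \<open>Cellular homology groups are freely generated by the cells\<close>

lemma hom_finprod:
  assumes "comm_group G" "comm_group H" "h \<in> hom G H" "f \<in> A \<rightarrow> carrier G"
  shows "h (finprod G f A) = finprod H (\<lambda>x. h (f x)) A"
proof -
  interpret G: comm_group G by fact
  interpret H: comm_group H by fact
  interpret h: group_hom G H h using assms(3) by unfold_locales
  show ?thesis using assms(4)
  proof (induction A rule: infinite_finite_induct)
    case (insert a A)
    then have "f \<in> A \<rightarrow> carrier G" "f a \<in> carrier G" by auto
    with insert show ?case by (simp add: Pi_iff)
  qed auto
qed

lemma (in comm_group) finprod_int_pow:
  assumes "f \<in> A \<rightarrow> carrier G"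
  shows "finprod G f A [^] (n::int) = finprod G (\<lambda>x. f x [^] n) A"
  using assms
proof (induction A rule: infinite_finite_induct)
  case (insert a A)
  then have "f \<in> A \<rightarrow> carrier G" "f a \<in> carrier G" by auto
  with insert show ?case by (simp add: Pi_iff int_pow_distrib)
qed auto

text \<open>Exponents compose like integer matrices. This produces the coefficients of a double
  boundary.\<close>

lemma (in comm_group) finprod_int_pow_sum:
  assumes "finite A" "c \<in> B \<rightarrow> carrier G"
  shows "finprod G (\<lambda>\<tau>. finprod G (\<lambda>\<rho>. c \<rho> [^] (m \<tau> \<rho> :: int)) B [^] (n \<tau> :: int)) A =
    finprod G (\<lambda>\<rho>. c \<rho> [^] (\<Sum>\<tau>\<in>A. n \<tau> * m \<tau> \<rho>)) B"
  using assms(1)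
proof (induction A rule: finite_induct)
  case empty
  then show ?case by simp
next
  case (insert a A)
  have c: "c \<rho> \<in> carrier G" if "\<rho> \<in> B" for \<rho> using assms(2) that by auto
  have cl: "finprod G (\<lambda>\<rho>. c \<rho> [^] m \<tau> \<rho>) B \<in> carrier G" for \<tau> using c by (auto intro!: finprod_closed)
  have "finprod G (\<lambda>\<tau>. finprod G (\<lambda>\<rho>. c \<rho> [^] m \<tau> \<rho>) B [^] n \<tau>) (insert a A)
     = finprod G (\<lambda>\<rho>. c \<rho> [^] m a \<rho>) B [^] n a \<otimes> finprod G (\<lambda>\<rho>. c \<rho> [^] (\<Sum>\<tau>\<in>A. n \<tau> * m \<tau> \<rho>)) B"
    using insert cl by simp
  also have "finprod G (\<lambda>\<rho>. c \<rho> [^] m a \<rho>) B [^] n a = finprod G (\<lambda>\<rho>. (c \<rho> [^] m a \<rho>) [^] n a) B"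
    using c by (intro finprod_int_pow) auto
  also have "\<dots> \<otimes> finprod G (\<lambda>\<rho>. c \<rho> [^] (\<Sum>\<tau>\<in>A. n \<tau> * m \<tau> \<rho>)) B
     = finprod G (\<lambda>\<rho>. (c \<rho> [^] m a \<rho>) [^] n a \<otimes> c \<rho> [^] (\<Sum>\<tau>\<in>A. n \<tau> * m \<tau> \<rho>)) B"
    using c by (intro finprod_multf[symmetric]) auto
  also have "\<dots> = finprod G (\<lambda>\<rho>. c \<rho> [^] (\<Sum>\<tau>\<in>insert a A. n \<tau> * m \<tau> \<rho>)) B"
    using c insert by (intro finprod_cong') (auto simp: int_pow_pow int_pow_mult mult.commute)
  finally show ?case .
qed

text \<open>The target is a space relative to all of itself, which has trivial homology. This kills
  the classes of cells lying in the relative subspace.\<close>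

lemma hom_induced_to_self:
  assumes "S \<subseteq> T"
  shows "hom_induced p X U (subtopology Y S) T f x = \<one>\<^bsub>relative_homology_group p (subtopology Y S) T\<^esub>"
proof -
  have "topspace (subtopology Y S) \<inter> T = topspace (subtopology Y S)" using assms by auto
  then have "trivial_group (relative_homology_group p (subtopology Y S) T)"
    using trivial_relative_homology_group_topspace[of p "subtopology Y S"]
    by (metis relative_homology_group_restrict)
  then show ?thesis using hom_induced_carrier[of p X U "subtopology Y S" T f x]
    by (auto simp: trivial_group_def)
qed

text \<open>The underlying set of \<open>X\<^sub>F\<close>, for \<open>l = k\<close>.\<close>

definition partial_skeleton :: "('a, 'c) cell_complex \<Rightarrow> nat \<Rightarrow> 'c set \<Rightarrow> 'a set" where
  "partial_skeleton X k F = skeleton X (int k - 1) \<union> (\<Union>\<sigma>\<in>F. open_cell X k \<sigma>)"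

definition partial_space :: "('a, 'c) cell_complex \<Rightarrow> nat \<Rightarrow> 'c set \<Rightarrow> 'a topology" where
  "partial_space X k F = subtopology (top_space X) (partial_skeleton X k F)"

text \<open>The relative subspace stays the lower skeleton while \<open>F\<close> grows. Inclusions
  thus carry classes to classes, and generation by the cell classes can be proved by adding the
  cells one at a time.\<close>

definition partial_class :: "('a, 'c) cell_complex \<Rightarrow> nat \<Rightarrow> 'c set \<Rightarrow> 'c \<Rightarrow> 'a chain set" where
  "partial_class X k F \<sigma> = hom_induced (int k) (unit_disc k) (disc_boundary k)
       (partial_space X k F) (skeleton X (int k - 1)) (char_map X k \<sigma>) (disc_class k)"

abbreviation partial_group :: "('a, 'c) cell_complex \<Rightarrow> nat \<Rightarrow> 'c set \<Rightarrow> 'a chain set monoid" where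
  "partial_group X k F \<equiv> relative_homology_group (int k) (partial_space X k F) (skeleton X (int k - 1))"

lemma skeleton_step: "skeleton X (int k) = partial_skeleton X k (cells X k)"
proof -
  have "{j. int j \<le> int k} = insert k {j. int j \<le> int k - 1}" by auto
  then show ?thesis unfolding partial_skeleton_def skeleton_def by auto
qed

lemma skeleton_space_eq: "skeleton_space X (int k) = partial_space X k (cells X k)"
  by (simp add: skeleton_space_def partial_space_def skeleton_step)

lemma cellular_group_eq: "cellular_group X k = partial_group X k (cells X k)"
  by (simp add: cellular_group_def skeleton_space_eq)

lemma cell_class_eq: "cell_class X k = partial_class X k (cells X k)"
  by (simp add: cell_class_def partial_class_def skeleton_space_eq fun_eq_iff)

lemma skeleton_mono: "i \<le> j \<Longrightarrow> skeleton X i \<subseteq> skeleton X j"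
  by (auto simp: skeleton_def) (meson order_trans)

lemma partial_skeleton_mono: "F \<subseteq> F' \<Longrightarrow> partial_skeleton X k F \<subseteq> partial_skeleton X k F'"
  by (auto simp: partial_skeleton_def)

lemma skeleton_subset_partial: "skeleton X (int k - 1) \<subseteq> partial_skeleton X k F"
  by (auto simp: partial_skeleton_def)

lemma subtopology_partial_space:
  "S \<subseteq> partial_skeleton X k F \<Longrightarrow> subtopology (partial_space X k F) S = subtopology (top_space X) S"
  by (simp add: partial_space_def subtopology_subtopology Int_absorb1)

section \<open>Skeleta of a finite complex and the classes of their cells\<close>

locale finite_complex =
  fixes X :: "('a, 'c) cell_complex"
  assumes finite_cell_complex: "finite_cell_complex X"
begin

lemma Hausdorff: "Hausdorff_space (top_space X)"
  and finite_all_cells: "finite (SIGMA k:UNIV. cells X k)"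
  and continuous_char: "\<sigma> \<in> cells X k \<Longrightarrow> continuous_map (unit_disc k) (top_space X) (char_map X k \<sigma>)"
  and inj_char: "\<sigma> \<in> cells X k \<Longrightarrow> inj_on (char_map X k \<sigma>) (open_disc k)"
  and char_boundary: "\<sigma> \<in> cells X k \<Longrightarrow> char_map X k \<sigma> ` disc_boundary k \<subseteq> skeleton X (int k - 1)"
  and disjoint_cells: "disjoint_family_on (\<lambda>(k, \<sigma>). open_cell X k \<sigma>) (SIGMA k:UNIV. cells X k)"
  and topspace_eq: "topspace (top_space X) = (\<Union>k. \<Union>\<sigma>\<in>cells X k. open_cell X k \<sigma>)"
  using finite_cell_complex unfolding finite_cell_complex_def by blast+

lemma finite_cells: "finite (cells X k)"
proof -
  have "cells X k \<subseteq> snd ` (SIGMA k:UNIV. cells X k)" by force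
  then show ?thesis using finite_all_cells finite_surj by blast
qed

lemma open_cells_disjoint:
  assumes "\<sigma> \<in> cells X k" "\<tau> \<in> cells X j" "(k, \<sigma>) \<noteq> (j, \<tau>)"
  shows "open_cell X k \<sigma> \<inter> open_cell X j \<tau> = {}"
  using disjoint_family_onD[OF disjoint_cells, of "(k, \<sigma>)" "(j, \<tau>)"] assms by auto

lemma skeleton_subset_topspace: "skeleton X j \<subseteq> topspace (top_space X)"
  unfolding topspace_eq skeleton_def by blast

lemma partial_skeleton_subset_topspace:
  "F \<subseteq> cells X k \<Longrightarrow> partial_skeleton X k F \<subseteq> topspace (top_space X)"
  using skeleton_subset_topspace unfolding partial_skeleton_def topspace_eq by blast

lemma topspace_partial_space: "F \<subseteq> cells X k \<Longrightarrow> topspace (partial_space X k F) = partial_skeleton X k F"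
  by (simp add: partial_space_def partial_skeleton_subset_topspace Int_absorb1)

lemma closed_cell_subset:
  "\<sigma> \<in> cells X k \<Longrightarrow> char_map X k \<sigma> ` topspace (unit_disc k) \<subseteq> skeleton X (int k - 1) \<union> open_cell X k \<sigma>"
  using char_boundary[of \<sigma> k] unfolding disc_partition(1) open_cell_def by blast

lemma closedin_closed_cell:
  assumes "\<sigma> \<in> cells X k"
  shows "closedin (top_space X) (char_map X k \<sigma> ` topspace (unit_disc k))"
proof -
  have "compactin (unit_disc k) (topspace (unit_disc k))"
    using compact_space_unit_disc by (simp add: compact_space_def)
  then show ?thesis
    using compactin_imp_closedin[OF Hausdorff] image_compactin continuous_char[OF assms] by blast
qed

text \<open>A skeleton is also the union of its closed cells, since the boundary of a cell lies in
  lower dimensions. There are finitely many of them, each compact and hence closed in a Hausdorff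
  space.\<close>

lemma closedin_skeleton: "closedin (top_space X) (skeleton X j)"
proof -
  let ?I = "{p \<in> (SIGMA k:UNIV. cells X k). int (fst p) \<le> j}"
  have "skeleton X j = (\<Union>(k, \<sigma>)\<in>?I. char_map X k \<sigma> ` topspace (unit_disc k))"
  proof
    show "skeleton X j \<subseteq> (\<Union>(k, \<sigma>)\<in>?I. char_map X k \<sigma> ` topspace (unit_disc k))"
    proof
      fix x assume "x \<in> skeleton X j"
      then obtain k \<sigma> where "int k \<le> j" "\<sigma> \<in> cells X k" "x \<in> open_cell X k \<sigma>"
        by (auto simp: skeleton_def)
      then have "(k, \<sigma>) \<in> ?I" "x \<in> char_map X k \<sigma> ` topspace (unit_disc k)"
        using disc_partition(1)[of k] by (auto simp: open_cell_def)
      then show "x \<in> (\<Union>(k, \<sigma>)\<in>?I. char_map X k \<sigma> ` topspace (unit_disc k))" by blast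
    qed
    show "(\<Union>(k, \<sigma>)\<in>?I. char_map X k \<sigma> ` topspace (unit_disc k)) \<subseteq> skeleton X j"
    proof clarify
      fix k \<sigma> u assume k: "int (fst (k, \<sigma>)) \<le> j" and \<sigma>: "\<sigma> \<in> cells X k" and u: "u \<in> topspace (unit_disc k)"
      have "open_cell X k \<sigma> \<subseteq> skeleton X j" using k \<sigma> by (auto simp: skeleton_def)
      moreover have "skeleton X (int k - 1) \<subseteq> skeleton X j" using k by (intro skeleton_mono) simp
      ultimately show "char_map X k \<sigma> u \<in> skeleton X j" using closed_cell_subset[OF \<sigma>] u by blast
    qed
  qed
  moreover have "closedin (top_space X) (\<Union>(k, \<sigma>)\<in>?I. char_map X k \<sigma> ` topspace (unit_disc k))"
    using finite_all_cells closedin_closed_cell by (intro closedin_Union) auto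
  ultimately show ?thesis by simp
qed

lemma closedin_partial_skeleton:
  assumes "F \<subseteq> cells X k"
  shows "closedin (top_space X) (partial_skeleton X k F)"
proof -
  have "skeleton X (int k - 1) \<union> open_cell X k \<sigma>
      = skeleton X (int k - 1) \<union> char_map X k \<sigma> ` topspace (unit_disc k)" if "\<sigma> \<in> F" for \<sigma>
    using char_boundary[of \<sigma> k] that assms unfolding disc_partition(1) open_cell_def image_Un by blast
  then have "partial_skeleton X k F = skeleton X (int k - 1) \<union> (\<Union>\<sigma>\<in>F. char_map X k \<sigma> ` topspace (unit_disc k))"
    unfolding partial_skeleton_def by blast
  moreover have "closedin (top_space X) (\<Union>\<sigma>\<in>F. char_map X k \<sigma> ` topspace (unit_disc k))"
    using assms finite_cells[of k] closedin_closed_cell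
    by (intro closedin_Union) (auto intro: finite_subset)
  ultimately show ?thesis using closedin_skeleton closedin_Un by metis
qed

lemma continuous_char_partial:
  assumes "\<sigma> \<in> cells X k" "\<sigma> \<in> F"
  shows "continuous_map (unit_disc k) (partial_space X k F) (char_map X k \<sigma>)"
proof -
  have "char_map X k \<sigma> ` topspace (unit_disc k) \<subseteq> partial_skeleton X k F"
    using closed_cell_subset[OF assms(1)] assms(2) by (auto simp: partial_skeleton_def)
  then show ?thesis using continuous_char[OF assms(1)]
    by (auto simp: partial_space_def continuous_map_in_subtopology)
qed

lemma partial_skeleton_disjoint:
  assumes "F \<subseteq> cells X k" "\<sigma> \<in> cells X k" "\<sigma> \<notin> F"
  shows "partial_skeleton X k F \<inter> open_cell X k \<sigma> = {}"
proof -
  have "open_cell X j \<tau> \<inter> open_cell X k \<sigma> = {}" if "\<tau> \<in> cells X j" "int j \<le> int k - 1" for j \<tau>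
    using that assms(2) by (intro open_cells_disjoint) auto
  moreover have "open_cell X k \<tau> \<inter> open_cell X k \<sigma> = {}" if "\<tau> \<in> F" for \<tau>
    using that assms by (intro open_cells_disjoint) auto
  ultimately show ?thesis unfolding partial_skeleton_def skeleton_def by blast
qed

lemma partial_attachment:
  assumes F: "F \<subseteq> cells X k" and \<sigma>: "\<sigma> \<in> cells X k" "\<sigma> \<notin> F"
  shows "cell_attachment k (partial_space X k (insert \<sigma> F)) (partial_skeleton X k F) (char_map X k \<sigma>)"
proof
  have sub: "insert \<sigma> F \<subseteq> cells X k" using F \<sigma> by simp
  show "Hausdorff_space (partial_space X k (insert \<sigma> F))"
    by (simp add: partial_space_def Hausdorff Hausdorff_space_subtopology)
  show "closedin (partial_space X k (insert \<sigma> F)) (partial_skeleton X k F)"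
    unfolding partial_space_def
    using closedin_partial_skeleton[OF F] partial_skeleton_mono[of F "insert \<sigma> F" X k]
    by (intro closedin_subset_topspace) auto
  show "continuous_map (unit_disc k) (partial_space X k (insert \<sigma> F)) (char_map X k \<sigma>)"
    using \<sigma> by (intro continuous_char_partial) auto
  show "char_map X k \<sigma> ` disc_boundary k \<subseteq> partial_skeleton X k F"
    using char_boundary[OF \<sigma>(1)] by (auto simp: partial_skeleton_def)
  show "topspace (partial_space X k (insert \<sigma> F)) = partial_skeleton X k F \<union> char_map X k \<sigma> ` open_disc k"
    unfolding topspace_partial_space[OF sub] by (auto simp: partial_skeleton_def open_cell_def)
qed (use inj_char[OF \<sigma>(1)] partial_skeleton_disjoint[OF assms] in \<open>auto simp: open_cell_def\<close>)

lemma partial_class_carrier: "partial_class X k F \<sigma> \<in> carrier (partial_group X k F)"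
  by (simp add: partial_class_def hom_induced_carrier)

lemma hom_induced_partial_class:
  assumes "\<sigma> \<in> cells X k" "\<sigma> \<in> F" "continuous_map (partial_space X k F) Z g" "g \<in> skeleton X (int k - 1) \<rightarrow> S"
  shows "hom_induced (int k) (partial_space X k F) (skeleton X (int k - 1)) Z S g (partial_class X k F \<sigma>)
    = hom_induced (int k) (unit_disc k) (disc_boundary k) Z S (g \<circ> char_map X k \<sigma>) (disc_class k)"
  unfolding partial_class_def
  using continuous_char_partial[OF assms(1,2)] char_boundary[OF assms(1)] assms(3,4)
  by (intro hom_induced_compose') auto

lemma hom_induced_partial_class_inclusion:
  assumes "F \<subseteq> F'" "\<sigma> \<in> F" "\<sigma> \<in> cells X k"
  shows "hom_induced (int k) (partial_space X k F) (skeleton X (int k - 1)) (partial_space X k F') (skeleton X (int k - 1)) id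
      (partial_class X k F \<sigma>) = partial_class X k F' \<sigma>"
proof -
  have "continuous_map (partial_space X k F) (partial_space X k F') id"
    using partial_skeleton_mono[OF assms(1), of X k] by (auto simp: partial_space_def continuous_map_in_subtopology)
  then show ?thesis
    using hom_induced_partial_class[OF assms(3,2), of "partial_space X k F'" id "skeleton X (int k - 1)"]
    by (simp add: partial_class_def)
qed

text \<open>Induction on \<open>F\<close>, by the exact sequence of the triple formed by the space
  with \<sigma> added, the space for \<open>F\<close>, and the lower skeleton. Relative to the
  second space the class of \<sigma> generates, so a multiple of it can be split off from
  \<open>x\<close>; the rest comes from the second space.\<close>

lemma partial_group_generated:
  assumes "F \<subseteq> cells X k" "x \<in> carrier (partial_group X k F)"
  shows "\<exists>n :: 'c \<Rightarrow> int. x = finprod (partial_group X k F) (\<lambda>\<sigma>. partial_class X k F \<sigma> [^]\<^bsub>partial_group X k F\<^esub> n \<sigma>) F"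
proof -
  have "finite F" using assms finite_cells finite_subset by blast
  then show ?thesis using assms
  proof (induction F arbitrary: x rule: finite_induct)
    case empty
    have "partial_skeleton X k {} = skeleton X (int k - 1)" by (simp add: partial_skeleton_def)
    then have "hom_induced (int k) (partial_space X k {}) (skeleton X (int k - 1)) (partial_space X k {}) (skeleton X (int k - 1)) id x
        = \<one>\<^bsub>partial_group X k {}\<^esub>"
      by (simp add: partial_space_def hom_induced_to_self)
    then show ?case using hom_induced_id[OF empty.prems(2)]
      by (simp add: comm_monoid.finprod_empty comm_group.axioms(1))
  next
    case (insert \<sigma> F)
    let ?S = "skeleton X (int k - 1)" and ?F' = "insert \<sigma> F"
    let ?G = "partial_group X k F" and ?G' = "partial_group X k ?F'"
    let ?H = "relative_homology_group (int k) (partial_space X k ?F') (partial_skeleton X k F)"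
    let ?i = "hom_induced (int k) (partial_space X k F) ?S (partial_space X k ?F') ?S id"
    let ?j = "hom_induced (int k) (partial_space X k ?F') ?S (partial_space X k ?F') (partial_skeleton X k F) id"
    interpret G: comm_group ?G by simp
    interpret G': comm_group ?G' by simp
    interpret H: comm_group ?H by simp
    interpret i: group_hom ?G ?G' ?i by unfold_locales (rule hom_induced_hom)
    interpret j: group_hom ?G' ?H ?j by unfold_locales (rule hom_induced_hom)
    have sub: "subtopology (partial_space X k ?F') (partial_skeleton X k F) = partial_space X k F"
      using partial_skeleton_mono[of F ?F' X k] by (subst subtopology_partial_space) (auto simp: partial_space_def)
    have ex: "?i ` carrier ?G = kernel ?G' ?H ?j"
      using homology_exactness_triple_3[OF skeleton_subset_partial[of X k F], of "int k" "partial_space X k ?F'"]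
      unfolding sub by simp
    interpret A: cell_attachment k "partial_space X k ?F'" "partial_skeleton X k F" "char_map X k \<sigma>"
      using insert by (intro partial_attachment) auto
    let ?f = "hom_induced (int k) (unit_disc k) (disc_boundary k) (partial_space X k ?F') (partial_skeleton X k F) (char_map X k \<sigma>)"
    have c: "partial_class X k ?F' \<tau> \<in> carrier ?G'" for \<tau> by (rule partial_class_carrier)
    have jc: "?j (partial_class X k ?F' \<sigma>) = ?f (disc_class k)"
    proof -
      have "id \<in> skeleton X (int k - 1) \<rightarrow> partial_skeleton X k F"
        using skeleton_subset_partial[of X k F] by auto
      then show ?thesis
        using hom_induced_partial_class[of \<sigma> k ?F' "partial_space X k ?F'" id "partial_skeleton X k F"] insert.prems by simp
    qed
    have "?f ` carrier (disc_homology k) = carrier ?H"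
      using A.iso_char[of "int k"] by (simp add: iso_def bij_betw_def)
    then have "?j x \<in> ?f ` carrier (disc_homology k)"
      using j.hom_closed[OF insert.prems(2)] by simp
    then obtain y where y: "y \<in> carrier (disc_homology k)" "?j x = ?f y"
      by (rule imageE) simp
    obtain n where n: "y = disc_class k [^]\<^bsub>disc_homology k\<^esub> (n::int)" using disc_homology_element[OF y(1)] .
    have "?j x = ?f (disc_class k) [^]\<^bsub>?H\<^esub> n"
      unfolding y n by (intro hom_int_pow hom_induced_hom disc_class_generates) auto
    then have jx: "?j x = ?j (partial_class X k ?F' \<sigma> [^]\<^bsub>?G'\<^esub> n)"
      using j.hom_int_pow[OF c] jc by simp
    let ?p = "partial_class X k ?F' \<sigma> [^]\<^bsub>?G'\<^esub> n"
    have "x \<otimes>\<^bsub>?G'\<^esub> inv\<^bsub>?G'\<^esub> ?p \<in> kernel ?G' ?H ?j"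
      using insert.prems c jx by (simp add: kernel_def)
    then have "x \<otimes>\<^bsub>?G'\<^esub> inv\<^bsub>?G'\<^esub> ?p \<in> ?i ` carrier ?G" by (simp only: ex)
    then obtain z where z: "z \<in> carrier ?G" "?i z = x \<otimes>\<^bsub>?G'\<^esub> inv\<^bsub>?G'\<^esub> ?p"
      by (rule imageE) simp
    obtain m where m: "z = finprod ?G (\<lambda>\<tau>. partial_class X k F \<tau> [^]\<^bsub>?G\<^esub> (m \<tau> :: int)) F"
      using insert.IH[OF _ z(1)] insert.prems by auto
    have iz: "?i z = finprod ?G' (\<lambda>\<tau>. partial_class X k ?F' \<tau> [^]\<^bsub>?G'\<^esub> m \<tau>) F"
    proof -
      have "?i z = finprod ?G' (\<lambda>\<tau>. ?i (partial_class X k F \<tau> [^]\<^bsub>?G\<^esub> m \<tau>)) F"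
        unfolding m by (intro hom_finprod hom_induced_hom) (auto simp: partial_class_carrier)
      also have "\<dots> = finprod ?G' (\<lambda>\<tau>. partial_class X k ?F' \<tau> [^]\<^bsub>?G'\<^esub> m \<tau>) F"
        using insert.prems(1) c
        by (intro G'.finprod_cong')
          (auto simp: i.hom_int_pow[OF partial_class_carrier] hom_induced_partial_class_inclusion[of F ?F'] subset_iff)
      finally show ?thesis .
    qed
    have "x = ?p \<otimes>\<^bsub>?G'\<^esub> ?i z"
      unfolding z(2) using insert.prems(2) c by (metis G'.int_pow_closed G'.inv_solve_right G'.m_comm i.hom_closed z)
    also have "\<dots> = finprod ?G' (\<lambda>\<tau>. partial_class X k ?F' \<tau> [^]\<^bsub>?G'\<^esub> (m(\<sigma> := n)) \<tau>) ?F'"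
    proof -
      have "finprod ?G' (\<lambda>\<tau>. partial_class X k ?F' \<tau> [^]\<^bsub>?G'\<^esub> (m(\<sigma> := n)) \<tau>) F
         = finprod ?G' (\<lambda>\<tau>. partial_class X k ?F' \<tau> [^]\<^bsub>?G'\<^esub> m \<tau>) F"
        using insert.hyps c by (intro G'.finprod_cong') auto
      then show ?thesis using insert.hyps c iz by (subst G'.finprod_insert) auto
    qed
    finally show ?case by blast
  qed
qed

text \<open>Coefficients are tested one at a time. Relative to all cells except \<sigma> the other
  classes vanish, while that of \<sigma> is the image of a generator of an infinite cyclic group
  under an isomorphism.\<close>

lemma partial_class_independent:
  assumes F: "F \<subseteq> cells X k" and \<sigma>: "\<sigma> \<in> F"
    and eq: "finprod (partial_group X k F) (\<lambda>\<tau>. partial_class X k F \<tau> [^]\<^bsub>partial_group X k F\<^esub> (n \<tau> :: int)) F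
      = \<one>\<^bsub>partial_group X k F\<^esub>"
  shows "n \<sigma> = 0"
proof -
  let ?S = "skeleton X (int k - 1)" and ?E = "F - {\<sigma>}"
  let ?G = "partial_group X k F"
  let ?H = "relative_homology_group (int k) (partial_space X k F) (partial_skeleton X k ?E)"
  let ?j = "hom_induced (int k) (partial_space X k F) ?S (partial_space X k F) (partial_skeleton X k ?E) id"
  let ?f = "\<lambda>\<tau>. hom_induced (int k) (unit_disc k) (disc_boundary k) (partial_space X k F) (partial_skeleton X k ?E) (char_map X k \<tau>)"
  interpret G: comm_group ?G by simp
  interpret H: comm_group ?H by simp
  interpret j: group_hom ?G ?H ?j by unfold_locales (rule hom_induced_hom)
  have ins: "insert \<sigma> ?E = F" using \<sigma> by auto
  interpret A: cell_attachment k "partial_space X k F" "partial_skeleton X k ?E" "char_map X k \<sigma>"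
    using partial_attachment[of ?E k \<sigma>] F \<sigma> unfolding ins by auto
  have c: "partial_class X k F \<tau> \<in> carrier ?G" for \<tau> by (rule partial_class_carrier)
  have jc: "?j (partial_class X k F \<tau>) = ?f \<tau> (disc_class k)" if "\<tau> \<in> F" for \<tau>
  proof -
    have "id \<in> skeleton X (int k - 1) \<rightarrow> partial_skeleton X k ?E"
      using skeleton_subset_partial[of X k ?E] by auto
    then show ?thesis
      using hom_induced_partial_class[of \<tau> k F "partial_space X k F" id "partial_skeleton X k ?E"] F that by (simp add: subset_iff)
  qed
  \<comment> \<open>The characteristic map of such a cell already lands in the relative subspace, so
    its class factors through the homology of a space relative to itself.\<close>
  have j1: "?j (partial_class X k F \<tau>) = \<one>\<^bsub>?H\<^esub>" if \<tau>: "\<tau> \<in> ?E" for \<tau>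
  proof -
    let ?K = "relative_homology_group (int k) (partial_space X k ?E) (partial_skeleton X k ?E)"
    let ?g = "hom_induced (int k) (unit_disc k) (disc_boundary k) (partial_space X k ?E) (partial_skeleton X k ?E) (char_map X k \<tau>)"
    let ?i = "hom_induced (int k) (partial_space X k ?E) (partial_skeleton X k ?E) (partial_space X k F) (partial_skeleton X k ?E) id"
    have "continuous_map (unit_disc k) (partial_space X k ?E) (char_map X k \<tau>)"
      using \<tau> F by (intro continuous_char_partial) auto
    moreover have "char_map X k \<tau> \<in> disc_boundary k \<rightarrow> partial_skeleton X k ?E"
      using char_boundary[of \<tau> k] \<tau> F skeleton_subset_partial[of X k ?E] by blast
    moreover have "continuous_map (partial_space X k ?E) (partial_space X k F) id"
      using partial_skeleton_mono[of ?E F X k] by (auto simp: partial_space_def continuous_map_in_subtopology)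
    ultimately have "?f \<tau> (disc_class k) = ?i (?g (disc_class k))"
      by (subst hom_induced_compose') auto
    also have "?g (disc_class k) = \<one>\<^bsub>?K\<^esub>"
      by (simp add: partial_space_def hom_induced_to_self)
    also have "?i \<one>\<^bsub>?K\<^esub> = \<one>\<^bsub>?H\<^esub>" by (intro hom_one[OF hom_induced_hom]) auto
    finally show ?thesis using jc \<tau> by simp
  qed
  have "\<one>\<^bsub>?H\<^esub> = ?j (finprod ?G (\<lambda>\<tau>. partial_class X k F \<tau> [^]\<^bsub>?G\<^esub> n \<tau>) F)"
    unfolding eq by (rule j.hom_one[symmetric])
  also have "\<dots> = finprod ?H (\<lambda>\<tau>. ?j (partial_class X k F \<tau> [^]\<^bsub>?G\<^esub> n \<tau>)) F"
    by (intro hom_finprod hom_induced_hom) (auto simp: c)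
  also have "\<dots> = finprod ?H (\<lambda>\<tau>. ?j (partial_class X k F \<tau>) [^]\<^bsub>?H\<^esub> n \<tau>) F"
    by (intro H.finprod_cong') (auto simp: c j.hom_int_pow)
  also have "\<dots> = ?j (partial_class X k F \<sigma>) [^]\<^bsub>?H\<^esub> n \<sigma> \<otimes>\<^bsub>?H\<^esub>
      finprod ?H (\<lambda>\<tau>. ?j (partial_class X k F \<tau>) [^]\<^bsub>?H\<^esub> n \<tau>) ?E"
    using F finite_cells[of k] by (subst (1) ins[symmetric], subst H.finprod_insert) (auto simp: c intro: finite_subset)
  also have "finprod ?H (\<lambda>\<tau>. ?j (partial_class X k F \<tau>) [^]\<^bsub>?H\<^esub> n \<tau>) ?E = \<one>\<^bsub>?H\<^esub>"
    using j1 by (intro H.finprod_one_eqI) (simp del: one_relative_homology_group)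
  also have "?j (partial_class X k F \<sigma>) [^]\<^bsub>?H\<^esub> n \<sigma> \<otimes>\<^bsub>?H\<^esub> \<one>\<^bsub>?H\<^esub> = ?j (partial_class X k F \<sigma>) [^]\<^bsub>?H\<^esub> n \<sigma>"
    using c by (intro H.r_one H.int_pow_closed j.hom_closed)
  also have "\<dots> = ?f \<sigma> (disc_class k [^]\<^bsub>disc_homology k\<^esub> n \<sigma>)"
    unfolding jc[OF \<sigma>]
    by (intro hom_int_pow[symmetric] hom_induced_hom disc_class_generates(1) group_relative_homology_group)
  finally have "?f \<sigma> (disc_class k [^]\<^bsub>disc_homology k\<^esub> n \<sigma>) = ?f \<sigma> \<one>\<^bsub>disc_homology k\<^esub>"
    unfolding hom_one[OF hom_induced_hom group_relative_homology_group group_relative_homology_group] by (rule sym)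
  moreover have "inj_on (?f \<sigma>) (carrier (disc_homology k))"
    using A.iso_char[of "int k"] by (simp add: iso_def bij_betw_def)
  ultimately have "disc_class k [^]\<^bsub>disc_homology k\<^esub> n \<sigma> = \<one>\<^bsub>disc_homology k\<^esub>"
    using disc_class_generates(1)
    by (metis group.int_pow_closed group_relative_homology_group inj_onD monoid.one_closed group.is_monoid)
  then show ?thesis by (rule disc_class_infinite_order)
qed

end


section \<open>Incidence numbers\<close>

text \<open>\<open>hom_relboundary\<close> is a connecting map followed by the passage to relative
  homology. In the double boundary this passage is followed by the connecting map of the same pair,
  and consecutive maps of an exact sequence compose to zero.\<close>

lemma hom_relboundary_twice:
  "hom_relboundary (p - 1) (subtopology Y S) T U (hom_relboundary p Y S T x)
   = \<one>\<^bsub>relative_homology_group (p - 1 - 1) (subtopology (subtopology Y S) T) U\<^esub>"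
proof -
  let ?Z = "subtopology Y S"
  let ?b = "hom_boundary p Y S x" and ?K = "homology_group (p - 1 - 1) (subtopology ?Z T)"
  have "?b \<in> carrier (homology_group (p - 1) ?Z)" by (rule hom_boundary_carrier)
  then have "hom_induced (p - 1) ?Z {} ?Z T id ?b \<in> hom_induced (p - 1) ?Z {} ?Z T id ` carrier (homology_group (p - 1) ?Z)"
    by (rule imageI)
  then have "hom_boundary (p - 1) ?Z T (hom_induced (p - 1) ?Z {} ?Z T id ?b) = \<one>\<^bsub>?K\<^esub>"
    using homology_exactness_axiom_1[of "p - 1" ?Z T] by (auto simp: kernel_def)
  then show ?thesis
    unfolding hom_relboundary_def comp_def by (simp add: hom_one[OF hom_induced_hom])
qed

context finite_complex begin

lemma subtopology_skeleton_space:
  "i \<le> j \<Longrightarrow> subtopology (skeleton_space X j) (skeleton X i) = skeleton_space X i"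
  using skeleton_mono[of i j X] by (simp add: skeleton_space_def subtopology_subtopology Int_absorb1)

lemma hom_relboundary_cellular:
  "hom_relboundary (int k + 1) (skeleton_space X (int k + 1)) (skeleton X (int k)) (skeleton X (int k - 1))
   \<in> hom (cellular_group X (Suc k)) (cellular_group X k)"
  using group_homomorphism_hom_relboundary[of "int k + 1" "skeleton_space X (int k + 1)" "skeleton X (int k)" "skeleton X (int k - 1)"]
  by (simp add: cellular_group_def subtopology_skeleton_space add.commute)

lemma comm_group_cellular: "comm_group (cellular_group X k)"
  by (simp add: cellular_group_def)

lemma cell_class_carrier: "cell_class X k \<sigma> \<in> carrier (cellular_group X k)"
  by (simp add: cell_class_eq cellular_group_eq partial_class_carrier)

text \<open>Since the cell classes generate, the \<open>SOME\<close> in the definition of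
  \<open>incidence\<close> picks an actual expansion of the boundary. Its values off the
  \<open>k\<close>-cells remain arbitrary.\<close>

lemma incidence_spec:
  "hom_relboundary (int k + 1) (skeleton_space X (int k + 1)) (skeleton X (int k)) (skeleton X (int k - 1)) (cell_class X (Suc k) \<sigma>)
   = finprod (cellular_group X k) (\<lambda>\<tau>. cell_class X k \<tau> [^]\<^bsub>cellular_group X k\<^esub> incidence X k \<sigma> \<tau>) (cells X k)"
proof -
  have "hom_relboundary (int k + 1) (skeleton_space X (int k + 1)) (skeleton X (int k)) (skeleton X (int k - 1)) (cell_class X (Suc k) \<sigma>)
      \<in> carrier (partial_group X k (cells X k))"
    using hom_in_carrier[OF hom_relboundary_cellular cell_class_carrier] by (simp add: cellular_group_eq)
  from partial_group_generated[OF subset_refl this]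
  show ?thesis unfolding incidence_def cell_class_eq[of X k, symmetric] cellular_group_eq[symmetric] by (rule someI_ex)
qed

lemma cell_class_independent:
  assumes "finprod (cellular_group X k) (\<lambda>\<tau>. cell_class X k \<tau> [^]\<^bsub>cellular_group X k\<^esub> (n \<tau> :: int)) (cells X k)
      = \<one>\<^bsub>cellular_group X k\<^esub>" "\<sigma> \<in> cells X k"
  shows "n \<sigma> = 0"
  using partial_class_independent[OF subset_refl assms(2)] assms(1)
  by (simp add: cell_class_eq cellular_group_eq)

text \<open>The sum is the coefficient of \<rho> in the double boundary of the class of \<sigma>.
  That boundary is trivial, and coefficients are unique by
  \<open>cell_class_independent\<close>.\<close>

lemma incidence_incidence:
  assumes "\<rho> \<in> cells X k"
  shows "(\<Sum>\<tau>\<in>cells X (Suc k). incidence X (Suc k) \<sigma> \<tau> * incidence X k \<tau> \<rho>) = 0"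
proof -
  let ?G = "cellular_group X (Suc k)" and ?H = "cellular_group X k"
  let ?d' = "hom_relboundary (int (Suc k) + 1) (skeleton_space X (int (Suc k) + 1)) (skeleton X (int (Suc k))) (skeleton X (int k))"
  let ?d = "hom_relboundary (int k + 1) (skeleton_space X (int k + 1)) (skeleton X (int k)) (skeleton X (int k - 1))"
  interpret G: comm_group ?G by (rule comm_group_cellular)
  interpret H: comm_group ?H by (rule comm_group_cellular)
  interpret d: group_hom ?G ?H ?d by unfold_locales (rule hom_relboundary_cellular)
  have "?d (?d' (cell_class X (Suc (Suc k)) \<sigma>)) = \<one>\<^bsub>?H\<^esub>"
    using hom_relboundary_twice[of "int (Suc k) + 1" "skeleton_space X (int (Suc k) + 1)" "skeleton X (int (Suc k))" "skeleton X (int k)"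
        "skeleton X (int k - 1)" "cell_class X (Suc (Suc k)) \<sigma>"]
    by (simp add: subtopology_skeleton_space cellular_group_def add.commute)
  also have "?d' (cell_class X (Suc (Suc k)) \<sigma>)
      = finprod ?G (\<lambda>\<tau>. cell_class X (Suc k) \<tau> [^]\<^bsub>?G\<^esub> incidence X (Suc k) \<sigma> \<tau>) (cells X (Suc k))"
    using incidence_spec[of "Suc k" \<sigma>] by simp
  also have "?d \<dots> = finprod ?H (\<lambda>\<tau>. ?d (cell_class X (Suc k) \<tau> [^]\<^bsub>?G\<^esub> incidence X (Suc k) \<sigma> \<tau>)) (cells X (Suc k))"
    by (intro hom_finprod comm_group_cellular hom_relboundary_cellular) (auto simp: cell_class_carrier)
  also have "\<dots> = finprod ?H (\<lambda>\<tau>. finprod ?H (\<lambda>\<rho>. cell_class X k \<rho> [^]\<^bsub>?H\<^esub> incidence X k \<tau> \<rho>) (cells X k)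
      [^]\<^bsub>?H\<^esub> incidence X (Suc k) \<sigma> \<tau>) (cells X (Suc k))"
    using cell_class_carrier by (simp add: d.hom_int_pow incidence_spec)
  also have "\<dots> = finprod ?H (\<lambda>\<rho>. cell_class X k \<rho> [^]\<^bsub>?H\<^esub>
      (\<Sum>\<tau>\<in>cells X (Suc k). incidence X (Suc k) \<sigma> \<tau> * incidence X k \<tau> \<rho>)) (cells X k)"
    by (intro H.finprod_int_pow_sum finite_cells) (simp add: cell_class_carrier)
  finally have eq: "finprod ?H (\<lambda>\<rho>. cell_class X k \<rho> [^]\<^bsub>?H\<^esub>
      (\<Sum>\<tau>\<in>cells X (Suc k). incidence X (Suc k) \<sigma> \<tau> * incidence X k \<tau> \<rho>)) (cells X k) = \<one>\<^bsub>?H\<^esub>" by simp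
  show ?thesis using cell_class_independent[OF eq assms] by simp
qed

lemma skeleton_minus_1: "skeleton X (-1) = {}"
  by (simp add: skeleton_def)

text \<open>Push the boundary of a \<open>1\<close>-cell to a one-point space, where every \<open>0\<close>-cell becomes the same generator.\<close>

lemma incidence_augmentation: "(\<Sum>v\<in>cells X 0. incidence X 0 \<sigma> v) = 0"
proof -
  let ?P = "discrete_topology {()}"
  let ?G = "cellular_group X 0" and ?H = "homology_group 0 ?P"
  let ?h = "hom_induced 0 (skeleton_space X 0) {} ?P {} (\<lambda>_. ())"
  define g where "g = hom_induced 0 (unit_disc 0) {} ?P {} (\<lambda>_. ()) (disc_class 0)"
  have G: "?G = homology_group 0 (skeleton_space X 0)" by (simp add: cellular_group_def skeleton_minus_1)
  interpret G: comm_group ?G by (rule comm_group_cellular)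
  interpret H: comm_group ?H by simp
  have "?h \<in> hom ?G ?H" unfolding G by (rule hom_induced_hom)
  then interpret h: group_hom ?G ?H ?h by unfold_locales
  let ?b = "hom_boundary 1 (skeleton_space X 1) (skeleton X 0) (cell_class X 1 \<sigma>)"
  have iso: "hom_induced 0 (unit_disc 0) {} ?P {} (\<lambda>_. ()) \<in> iso (disc_homology 0) ?H"
  proof -
    have "homeomorphic_map (unit_disc 0) ?P (\<lambda>_. ())"
      unfolding homeomorphic_map_maps homeomorphic_maps_def
      by (rule exI[of _ "\<lambda>_. (\<lambda>_. 0)"]) (auto simp: topspace_unit_disc_0 topspace_unit_disc)
    from homeomorphic_map_homology_iso[OF this, of 0] show ?thesis by (simp add: disc_boundary_0)
  qed
  have g: "g \<in> carrier ?H" unfolding g_def by (rule hom_induced_carrier)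
  have c: "cell_class X 0 v \<in> carrier ?G" for v by (rule cell_class_carrier)
  have hv: "?h (cell_class X 0 v) = g" if "v \<in> cells X 0" for v
  proof -
    have "continuous_map (unit_disc 0) (skeleton_space X 0) (char_map X 0 v)"
      using continuous_char_partial[OF that that] skeleton_space_eq[of X 0] by simp
    then show ?thesis
      unfolding cell_class_def g_def by (simp add: skeleton_minus_1 disc_boundary_0 hom_induced_compose' o_def)
  qed
  \<comment> \<open>By exactness the boundary of a 1-dimensional class dies in the homology of the
    1-skeleton, and the map to the point factors through that homology.\<close>
  have "?h ?b = \<one>\<^bsub>?H\<^esub>"
  proof -
    have cc: "cell_class X 1 \<sigma> \<in> carrier (relative_homology_group 1 (skeleton_space X 1) (skeleton X 0))"
      using cell_class_carrier[of 1 \<sigma>] by (simp add: cellular_group_def)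
    have e: "hom_boundary 1 (skeleton_space X 1) (skeleton X 0) ` carrier (relative_homology_group 1 (skeleton_space X 1) (skeleton X 0))
      = kernel (homology_group 0 (skeleton_space X 0)) (homology_group 0 (skeleton_space X 1))
         (hom_induced 0 (skeleton_space X 0) {} (skeleton_space X 1) {} id)"
      using homology_exactness_axiom_2[of 1 "skeleton_space X 1" "skeleton X 0"]
      by (simp add: subtopology_skeleton_space)
    have "?b \<in> kernel (homology_group 0 (skeleton_space X 0)) (homology_group 0 (skeleton_space X 1))
         (hom_induced 0 (skeleton_space X 0) {} (skeleton_space X 1) {} id)"
      unfolding e[symmetric] using cc by (rule imageI)
    then have "hom_induced 0 (skeleton_space X 0) {} (skeleton_space X 1) {} id ?b = \<one>\<^bsub>homology_group 0 (skeleton_space X 1)\<^esub>"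
      by (simp add: kernel_def)
    moreover have "continuous_map (skeleton_space X 0) (skeleton_space X 1) id"
      using skeleton_mono[of 0 1 X] by (auto simp: skeleton_space_def continuous_map_in_subtopology)
    then have "?h ?b = hom_induced 0 (skeleton_space X 1) {} ?P {} (\<lambda>_. ())
        (hom_induced 0 (skeleton_space X 0) {} (skeleton_space X 1) {} id ?b)"
      by (subst hom_induced_compose') (auto simp: o_def)
    ultimately show ?thesis using hom_one[OF hom_induced_hom] by simp
  qed
  also have "?b = finprod ?G (\<lambda>v. cell_class X 0 v [^]\<^bsub>?G\<^esub> incidence X 0 \<sigma> v) (cells X 0)"
    using incidence_spec[of 0 \<sigma>] by (simp add: skeleton_minus_1 hom_relboundary_empty)
  also have "?h \<dots> = finprod ?H (\<lambda>v. ?h (cell_class X 0 v [^]\<^bsub>?G\<^esub> incidence X 0 \<sigma> v)) (cells X 0)"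
    by (intro hom_finprod comm_group_cellular h.homh) (auto simp: cell_class_carrier)
  also have "\<dots> = finprod ?H (\<lambda>v. g [^]\<^bsub>?H\<^esub> incidence X 0 \<sigma> v) (cells X 0)"
    using c g hv by (intro H.finprod_cong') (auto simp: h.hom_int_pow)
  also have "\<dots> = g [^]\<^bsub>?H\<^esub> (\<Sum>v\<in>cells X 0. incidence X 0 \<sigma> v)"
  proof -
    have "finite A \<Longrightarrow> finprod ?H (\<lambda>v. g [^]\<^bsub>?H\<^esub> (n v :: int)) A = g [^]\<^bsub>?H\<^esub> (\<Sum>v\<in>A. n v)" for A :: "'c set" and n
      by (induction A rule: finite_induct) (auto simp: H.int_pow_mult g)
    then show ?thesis using finite_cells by blast
  qed
  also have "\<dots> = hom_induced 0 (unit_disc 0) {} ?P {} (\<lambda>_. ()) (disc_class 0 [^]\<^bsub>disc_homology 0\<^esub> (\<Sum>v\<in>cells X 0. incidence X 0 \<sigma> v))"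
    unfolding g_def using iso disc_class_generates(1)[of 0] by (intro hom_int_pow[symmetric]) (auto simp: iso_def)
  finally have eq: "hom_induced 0 (unit_disc 0) {} ?P {} (\<lambda>_. ()) (disc_class 0 [^]\<^bsub>disc_homology 0\<^esub> (\<Sum>v\<in>cells X 0. incidence X 0 \<sigma> v))
      = hom_induced 0 (unit_disc 0) {} ?P {} (\<lambda>_. ()) \<one>\<^bsub>disc_homology 0\<^esub>"
    using iso hom_one[of "hom_induced 0 (unit_disc 0) {} ?P {} (\<lambda>_. ())" "disc_homology 0" ?H] by (simp add: iso_def)
  interpret D: group "disc_homology 0" by simp
  have "inj_on (hom_induced 0 (unit_disc 0) {} ?P {} (\<lambda>_. ())) (carrier (disc_homology 0))"
    using iso by (simp add: iso_def bij_betw_def)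
  from inj_on_eq_iff[OF this D.int_pow_closed[OF disc_class_generates(1)] D.one_closed] eq
  have "disc_class 0 [^]\<^bsub>disc_homology 0\<^esub> (\<Sum>v\<in>cells X 0. incidence X 0 \<sigma> v) = \<one>\<^bsub>disc_homology 0\<^esub>"
    by blast
  then show ?thesis by (rule disc_class_infinite_order)
qed

section \<open>Subcomplexes containing the lower skeleton\<close>

lemma skeleton_add_cells:
  assumes "F \<subseteq> cells X l"
  shows "j < int l \<Longrightarrow> skeleton (add_cells X l F) j = skeleton X j"
    and "skeleton (add_cells X l F) (int l) = partial_skeleton X l F"
proof -
  have op: "open_cell (add_cells X l F) = open_cell X" by (simp add: open_cell_def add_cells_def fun_eq_iff)
  show *: "skeleton (add_cells X l F) j = skeleton X j" if "j < int l" for j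
    using that unfolding skeleton_def op by (auto simp: add_cells_def)
  show "skeleton (add_cells X l F) (int l) = partial_skeleton X l F"
    using *[of "int l - 1"] unfolding skeleton_step partial_skeleton_def op by (simp add: add_cells_def)
qed

lemma top_space_add_cells: "top_space (add_cells X l F) = partial_space X l F"
  by (simp add: add_cells_def partial_space_def partial_skeleton_def)

lemma skeleton_space_add_cells:
  assumes "F \<subseteq> cells X l"
  shows "j < int l \<Longrightarrow> skeleton_space (add_cells X l F) j = skeleton_space X j"
    and "skeleton_space (add_cells X l F) (int l) = partial_space X l F"
proof -
  show "skeleton_space (add_cells X l F) j = skeleton_space X j" if "j < int l" for j
    using skeleton_mono[of j "int l - 1" X] that skeleton_subset_partial[of X l F]
    unfolding skeleton_space_def skeleton_add_cells(1)[OF assms that] top_space_add_cells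
    by (subst subtopology_partial_space) auto
  show "skeleton_space (add_cells X l F) (int l) = partial_space X l F"
    unfolding skeleton_space_def skeleton_add_cells(2)[OF assms] top_space_add_cells
    by (simp add: subtopology_partial_space partial_space_def[symmetric])
qed

lemma cells_add_cells: "k < l \<Longrightarrow> cells (add_cells X l F) k = cells X k" "cells (add_cells X l F) l = F"
  "k > l \<Longrightarrow> cells (add_cells X l F) k = {}"
  by (auto simp: add_cells_def)

lemma cellular_group_add_cells:
  "F \<subseteq> cells X l \<Longrightarrow> k < l \<Longrightarrow> cellular_group (add_cells X l F) k = cellular_group X k"
  by (simp add: cellular_group_def skeleton_space_add_cells skeleton_add_cells)

lemma cell_class_add_cells:
  "F \<subseteq> cells X l \<Longrightarrow> k < l \<Longrightarrow> cell_class (add_cells X l F) k = cell_class X k"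
  "F \<subseteq> cells X l \<Longrightarrow> cell_class (add_cells X l F) l = partial_class X l F"
  by (simp_all add: cell_class_def partial_class_def skeleton_space_add_cells skeleton_add_cells fun_eq_iff)
    (simp_all add: add_cells_def)

text \<open>Naturality of the boundary map under the inclusion of \<open>X\<^sub>F\<close>, which is the identity on the \<open>(l-1)\<close>-skeleton.\<close>

lemma incidence_add_cells:
  assumes "F \<subseteq> cells X l" "Suc k \<le> l" "\<sigma> \<in> cells (add_cells X l F) (Suc k)"
  shows "incidence (add_cells X l F) k \<sigma> = incidence X k \<sigma>"
proof -
  let ?Y = "add_cells X l F"
  have "hom_relboundary (int k + 1) (skeleton_space ?Y (int k + 1)) (skeleton X (int k)) (skeleton X (int k - 1)) (cell_class ?Y (Suc k) \<sigma>)
    = hom_relboundary (int k + 1) (skeleton_space X (int k + 1)) (skeleton X (int k)) (skeleton X (int k - 1)) (cell_class X (Suc k) \<sigma>)"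
  proof (cases "Suc k < l")
    case True
    then show ?thesis using assms(1) by (simp add: skeleton_space_add_cells cell_class_add_cells)
  next
    case False
    then have l: "l = Suc k" using assms(2) by simp
    have \<sigma>: "\<sigma> \<in> F" "\<sigma> \<in> cells X l" using assms(1,3) unfolding l by (auto simp: add_cells_def)
    let ?P = "partial_space X l F" and ?P' = "partial_space X l (cells X l)"
    let ?S = "skeleton X (int k)" and ?T = "skeleton X (int k - 1)"
    have S: "?S = skeleton X (int l - 1)" by (simp add: l)
    have SP: "?S \<subseteq> partial_skeleton X l E" for E unfolding S by (rule skeleton_subset_partial)
    have eqs: "skeleton_space ?Y (int k + 1) = ?P" "skeleton_space X (int k + 1) = ?P'"
      "cell_class ?Y (Suc k) = partial_class X l F" "cell_class X (Suc k) = partial_class X l (cells X l)"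
      using skeleton_space_add_cells(2)[OF assms(1)] skeleton_space_eq[of X l] cell_class_add_cells(2)[OF assms(1)]
        cell_class_eq[of X l] by (simp_all add: l add.commute)
    have cont: "continuous_map ?P ?P' id"
      using partial_skeleton_mono[OF assms(1), of X l] by (auto simp: partial_space_def continuous_map_in_subtopology)
    have sub: "subtopology ?P ?S = skeleton_space X (int k)" "subtopology ?P' ?S = skeleton_space X (int k)"
      by (simp_all add: subtopology_partial_space SP skeleton_space_def)
    have "hom_relboundary (int k + 1) ?P' ?S ?T (hom_induced (int k + 1) ?P ?S ?P' ?S id (partial_class X l F \<sigma>))
      = hom_induced (int k) (skeleton_space X (int k)) ?T (skeleton_space X (int k)) ?T id
         (hom_relboundary (int k + 1) ?P ?S ?T (partial_class X l F \<sigma>))"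
      using naturality_hom_induced_relboundary[OF cont, of ?S ?S ?T ?T "int k + 1"]
      unfolding sub by (simp add: fun_eq_iff)
    also have "hom_induced (int k + 1) ?P ?S ?P' ?S id (partial_class X l F \<sigma>) = partial_class X l (cells X l) \<sigma>"
      using hom_induced_partial_class_inclusion[OF assms(1) \<sigma>] by (simp add: l add.commute)
    also have "hom_induced (int k) (skeleton_space X (int k)) ?T (skeleton_space X (int k)) ?T id
         (hom_relboundary (int k + 1) ?P ?S ?T (partial_class X l F \<sigma>))
      = hom_relboundary (int k + 1) ?P ?S ?T (partial_class X l F \<sigma>)"
      using hom_relboundary[of "int k + 1" ?P ?S ?T] unfolding sub by (intro hom_induced_id) simp
    finally show ?thesis unfolding eqs by simp
  qed
  \<comment> \<open>Both sides are choices by \<open>SOME\<close>. Their defining conditions have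
    become identical, hence the chosen functions agree at every label, including those that are not
    \<open>k\<close>-cells.\<close>
  then show ?thesis unfolding incidence_def using assms
    by (simp add: skeleton_add_cells cellular_group_add_cells cell_class_add_cells cells_add_cells)
qed

end


section \<open>Linear algebra\<close>

no_notation vector_scalar_mult (infixl "*s" 70)

context vector_space begin

lemma scaled_in_span: "a \<noteq> 0 \<Longrightarrow> a *s x \<in> span S \<Longrightarrow> x \<in> span S"
  using span_scale[of "a *s x" S "inverse a"] by simp

text \<open>A basis of a subspace is split into the vectors \<open>w i\<close> and the rest, and the
  former are a basis modulo the span of the latter. In the barcode the rest are the dead vectors; in
  rank-nullity nothing is left over.\<close>

lemma representation_modulo_complement:
  assumes indep: "independent W" and J: "finite J" "inj_on w J" "w ` J \<subseteq> W" and c: "c \<in> span W"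
  shows "\<exists>!a. (\<forall>i. i \<notin> J \<longrightarrow> a i = 0) \<and> c - (\<Sum>i\<in>J. a i *s w i) \<in> span (W - w ` J)"
proof (rule ex_ex1I)
  have "w ` J \<union> (W - w ` J) = W" using J(3) by blast
  then obtain x y where xy: "c = x + y" "x \<in> span (w ` J)" "y \<in> span (W - w ` J)"
    using c span_Un[of "w ` J" "W - w ` J"] by auto
  obtain u where "x = (\<Sum>v\<in>w ` J. u v *s v)" using xy(2) J(1) by (auto simp: span_finite)
  then have "x = (\<Sum>i\<in>J. u (w i) *s w i)" using J(2) by (simp add: sum.reindex)
  \<comment> \<open>Coefficients are set to 0 outside \<open>J\<close>, as otherwise they could not
    be unique.\<close>
  also have "\<dots> = (\<Sum>i\<in>J. (if i \<in> J then u (w i) else 0) *s w i)" by (intro sum.cong) auto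
  finally have "c - (\<Sum>i\<in>J. (if i \<in> J then u (w i) else 0) *s w i) = y" using xy(1) by simp
  with xy(3) have "c - (\<Sum>i\<in>J. (if i \<in> J then u (w i) else 0) *s w i) \<in> span (W - w ` J)" by metis
  then show "\<exists>a. (\<forall>i. i \<notin> J \<longrightarrow> a i = 0) \<and> c - (\<Sum>i\<in>J. a i *s w i) \<in> span (W - w ` J)"
    by (intro exI[of _ "\<lambda>i. if i \<in> J then u (w i) else 0"] conjI) auto
next
  fix a a' assume a: "(\<forall>i. i \<notin> J \<longrightarrow> a i = 0) \<and> c - (\<Sum>i\<in>J. a i *s w i) \<in> span (W - w ` J)"
    and a': "(\<forall>i. i \<notin> J \<longrightarrow> a' i = 0) \<and> c - (\<Sum>i\<in>J. a' i *s w i) \<in> span (W - w ` J)"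
  define d where "d i = a' i - a i" for i
  have "(c - (\<Sum>i\<in>J. a i *s w i)) - (c - (\<Sum>i\<in>J. a' i *s w i)) \<in> span (W - w ` J)"
    by (rule span_diff[OF conjunct2[OF a] conjunct2[OF a']])
  then have d: "(\<Sum>i\<in>J. d i *s w i) \<in> span (W - w ` J)"
    by (simp add: d_def scale_left_diff_distrib sum_subtractf algebra_simps)
  have "d j = 0" if j: "j \<in> J" for j
  proof (rule ccontr)
    assume dj: "d j \<noteq> 0"
    have "W - w ` J \<subseteq> W - {w j}" using j by blast
    then have "(\<Sum>i\<in>J. d i *s w i) \<in> span (W - {w j})" using d span_mono by blast
    moreover have "(\<Sum>i\<in>J - {j}. d i *s w i) \<in> span (W - {w j})"
      using J j by (intro span_sum span_scale span_base) (auto dest: inj_onD)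
    moreover have "(\<Sum>i\<in>J. d i *s w i) = d j *s w j + (\<Sum>i\<in>J - {j}. d i *s w i)"
      using J(1) j by (simp add: sum.remove)
    ultimately have "d j *s w j \<in> span (W - {w j})"
      using span_diff[of "\<Sum>i\<in>J. d i *s w i" _ "\<Sum>i\<in>J - {j}. d i *s w i"] by simp
    then have "w j \<in> span (W - {w j})" by (rule scaled_in_span[OF dj])
    then show False using indep J(3) j unfolding dependent_def by blast
  qed
  then have "a' i = a i" for i using a a' by (cases "i \<in> J") (auto simp: d_def)
  then show "a = a'" by auto
qed

text \<open>Unique representability modulo \<open>B\<close> says that the \<open>z i\<close> form a
  basis of the quotient of \<open>Z\<close> by \<open>B\<close>; together with a basis of
  \<open>B\<close> they form one of \<open>Z\<close>. The hypothesis \<open>rep\<close> has the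
  shape of the condition in \<open>barcode\<close>. The finite set \<open>T\<close> provides finite
  dimension, as the ambient space may be infinite-dimensional.\<close>

lemma dim_modulo:
  assumes Z: "subspace Z" and B: "subspace B" "B \<subseteq> Z" and T: "finite T" "Z \<subseteq> span T"
    and J: "finite J" "\<And>i. i \<in> J \<Longrightarrow> z i \<in> Z"
    and rep: "\<And>c. c \<in> Z \<Longrightarrow> \<exists>!a. (\<forall>i. i \<notin> J \<longrightarrow> a i = 0) \<and> c - (\<Sum>i\<in>J. a i *s z i) \<in> B"
  shows "dim Z = card J + dim B"
proof -
  obtain S where S: "S \<subseteq> B" "independent S" "B \<subseteq> span S" "card S = dim B"
    using basis_exists by blast
  have finS: "finite S" using independent_span_bound[OF T(1) S(2)] S(1) B(2) T(2) by blast
  \<comment> \<open>Uniqueness is applied to the representations of 0: both the given coefficients,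
    cut off outside \<open>J\<close>, and the zero coefficients represent it.\<close>
  have zero: "a i = 0" if "(\<Sum>i\<in>J. a i *s z i) \<in> B" "i \<in> J" for a i
  proof -
    define a' where "a' = (\<lambda>i. if i \<in> J then a i else 0)"
    have "(\<Sum>i\<in>J. a' i *s z i) = (\<Sum>i\<in>J. a i *s z i)" by (simp add: a'_def)
    then have "0 - (\<Sum>i\<in>J. a' i *s z i) \<in> B" using that(1) B(1) subspace_neg by simp
    moreover have "0 - (\<Sum>i\<in>J. (0::'a) *s z i) \<in> B" using B(1) subspace_0 by simp
    moreover have "\<exists>!a. (\<forall>i. i \<notin> J \<longrightarrow> a i = 0) \<and> 0 - (\<Sum>i\<in>J. a i *s z i) \<in> B"
      using rep[of 0] Z subspace_0 by simp
    ultimately have "a' = (\<lambda>i. 0)" by (auto simp: a'_def)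
    then show ?thesis using that(2) by (metis a'_def)
  qed
  have sumif: "(\<Sum>m\<in>J. (if m = i then x else 0) *s z m) = x *s z i" if "i \<in> J" for i x
    using J(1) that by (simp add: if_distrib[of "\<lambda>a. a *s _"] cong: if_cong)
  have notB: "z i \<notin> B" if "i \<in> J" for i
    using zero[of "\<lambda>m. if m = i then 1 else 0" i] sumif[OF that, of 1] that by auto
  have inj: "inj_on z J"
  proof (rule inj_onI, rule ccontr)
    fix i j assume ij: "i \<in> J" "j \<in> J" "z i = z j" "i \<noteq> j"
    have "(\<Sum>m\<in>J. ((if m = i then 1 else 0) - (if m = j then 1 else 0)) *s z m) = 0"
      using ij sumif[of i 1] sumif[of j 1] by (simp add: scale_left_diff_distrib sum_subtractf)
    then have "(if i = i then 1 else 0) - (if i = j then 1 else 0) = (0::'a)"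
      using ij B(1) subspace_0 by (intro zero) auto
    then show False using ij by simp
  qed
  have disj: "z ` J \<inter> S = {}" using notB S(1) by blast
  have "independent (z ` J \<union> S)"
  proof (rule independent_if_scalars_zero)
    show "finite (z ` J \<union> S)" using J(1) finS by simp
    fix f x assume f: "(\<Sum>v\<in>z ` J \<union> S. f v *s v) = 0" and x: "x \<in> z ` J \<union> S"
    have split: "(\<Sum>v\<in>z ` J \<union> S. f v *s v) = (\<Sum>i\<in>J. f (z i) *s z i) + (\<Sum>v\<in>S. f v *s v)"
      using J(1) finS disj inj by (simp add: sum.union_disjoint sum.reindex)
    have SB: "(\<Sum>v\<in>S. f v *s v) \<in> B" using S(1) B(1) by (intro subspace_sum subspace_scale) auto
    have "(\<Sum>i\<in>J. f (z i) *s z i) = - (\<Sum>v\<in>S. f v *s v)" using f split by (simp add: eq_neg_iff_add_eq_0)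
    then have "(\<Sum>i\<in>J. f (z i) *s z i) \<in> B" using SB B(1) subspace_neg by simp
    then have fz: "f (z i) = 0" if "i \<in> J" for i using zero[of "\<lambda>i. f (z i)"] that by blast
    then have "(\<Sum>v\<in>S. f v *s v) = 0" using f split by simp
    then have "f v = 0" if "v \<in> S" for v using independentD[OF S(2) finS subset_refl] that by blast
    with fz x show "f x = 0" by auto
  qed
  moreover have "span (z ` J \<union> S) = span Z"
  proof
    show "span (z ` J \<union> S) \<subseteq> span Z" using J(2) S(1) B(2) by (intro span_mono) auto
    have "c \<in> span (z ` J \<union> S)" if c: "c \<in> Z" for c
    proof -
      obtain a where "c - (\<Sum>i\<in>J. a i *s z i) \<in> B" using rep[OF c] by blast
      then have "c - (\<Sum>i\<in>J. a i *s z i) \<in> span (z ` J \<union> S)"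
        using S(3) span_mono[of S "z ` J \<union> S"] by blast
      moreover have "(\<Sum>i\<in>J. a i *s z i) \<in> span (z ` J \<union> S)"
        by (intro span_sum span_scale span_base) auto
      ultimately show ?thesis by (metis diff_add_cancel span_add)
    qed
    then show "span Z \<subseteq> span (z ` J \<union> S)" by (intro span_minimal subspace_span) auto
  qed
  ultimately have "dim Z = card (z ` J \<union> S)" by (intro dim_eq_card)
  then show ?thesis using J(1) finS disj inj S(4) by (simp add: card_Un_disjoint card_image)
qed

text \<open>The greedy algorithm: run through \<open>F\<close> in the order of \<open>t\<close>, keeping the vectors that are independent of the earlier ones.\<close>

lemma greedy_basis:
  fixes t :: "'i \<Rightarrow> real"
  assumes "finite F"
  shows "\<exists>I\<subseteq>F. inj_on b I \<and> independent (b ` I) \<and>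
    (\<forall>s. span (b ` {i\<in>I. t i \<le> s}) = span (b ` {i\<in>F. t i \<le> s}))"
  using assms
proof (induction F rule: finite_ranking_induct[where f=t])
  case empty
  then show ?case by (auto simp: independent_empty)
next
  case (insert x S)
  then obtain I where I: "I \<subseteq> S" "inj_on b I" "independent (b ` I)"
    "\<And>s. span (b ` {i\<in>I. t i \<le> s}) = span (b ` {i\<in>S. t i \<le> s})" by blast
  \<comment> \<open>The new element has the largest time, so a time bound that admits it admits
    everything.\<close>
  have later: "{i\<in>I. t i \<le> s} = I" "{i\<in>S. t i \<le> s} = S" if "t x \<le> s" for s
    using insert.hyps(2) I(1) that by force+
  have spans: "span (b ` I) = span (b ` S)" using I(4)[of "t x"] later[of "t x"] by simp
  show ?case
  proof (cases "b x \<in> span (b ` I)")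
    case True
    have "span (b ` {i\<in>I. t i \<le> s}) = span (b ` {i\<in>insert x S. t i \<le> s})" for s
    proof (cases "t x \<le> s")
      case t: True
      then have "{i\<in>insert x S. t i \<le> s} = insert x S" using later by blast
      then show ?thesis using later(1)[OF t] spans True by (simp add: span_redundant)
    next
      case False
      then have "{i\<in>insert x S. t i \<le> s} = {i\<in>S. t i \<le> s}" by auto
      then show ?thesis using I(4) by simp
    qed
    then show ?thesis using I by (intro exI[of _ I]) auto
  next
    case False
    then have "b x \<notin> b ` I" using span_base[of "b x" "b ` I"] by blast
    moreover have "independent (b ` insert x I)" using independent_insertI[OF False I(3)] by simp
    moreover have "span (b ` {i\<in>insert x I. t i \<le> s}) = span (b ` {i\<in>insert x S. t i \<le> s})" for s
    proof (cases "t x \<le> s")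
      case t: True
      then have "{i\<in>insert x S. t i \<le> s} = insert x S" "{i\<in>insert x I. t i \<le> s} = insert x I"
        using later by blast+
      then show ?thesis by (simp only: image_insert span_insert spans)
    next
      case False
      then have "{i\<in>insert x S. t i \<le> s} = {i\<in>S. t i \<le> s}" "{i\<in>insert x I. t i \<le> s} = {i\<in>I. t i \<le> s}" by auto
      then show ?thesis using I(4) by simp
    qed
    ultimately show ?thesis using I(1,2) by (intro exI[of _ "insert x I"]) (auto simp: inj_on_insert)
  qed
qed

end


section \<open>Betti numbers of the subcomplexes\<close>

text \<open>Values of \<open>incidence\<close> off the \<open>k\<close>-cells are arbitrary, and are
  replaced by 0 so that the vector is a chain.\<close>

definition boundary_vector :: "('a, 'c) cell_complex \<Rightarrow> nat \<Rightarrow> 'c \<Rightarrow> 'c \<Rightarrow> 'k::field_char_0" where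
  "boundary_vector X k \<sigma> = (\<lambda>\<tau>. if \<tau> \<in> cells X k then of_int (incidence X k \<sigma> \<tau>) else 0)"

definition supported :: "'c set \<Rightarrow> ('c \<Rightarrow> 'k::field_char_0) set" where
  "supported F = {c. \<forall>\<sigma>. \<sigma> \<notin> F \<longrightarrow> c \<sigma> = 0}"

definition unit_chain :: "'c \<Rightarrow> 'c \<Rightarrow> 'k::field_char_0" where
  "unit_chain \<sigma> = (\<lambda>\<tau>. if \<tau> = \<sigma> then 1 else 0)"

text \<open>As a function of \<open>c\<close> this is the linear map that sends the unit chain of a
  label \<sigma> in \<open>F\<close> to \<open>b \<sigma>\<close>. The boundary map has this form,
  and so does the identity on chains supported in \<open>F\<close>, with \<open>unit_chain\<close>
  for \<open>b\<close>.\<close>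

definition combination :: "('c \<Rightarrow> 'd \<Rightarrow> 'k) \<Rightarrow> 'c set \<Rightarrow> ('c \<Rightarrow> 'k::field_char_0) \<Rightarrow> 'd \<Rightarrow> 'k" where
  "combination b F c = (\<Sum>\<sigma>\<in>F. scale_chain (c \<sigma>) (b \<sigma>))"

lemma sum_apply: "(\<Sum>i\<in>A. f i) x = (\<Sum>i\<in>A. f i (x :: 'x) :: 'y::comm_monoid_add)"
  by (induction A rule: infinite_finite_induct) (auto simp: zero_fun_def plus_fun_def)

lemma combination_apply: "combination b F c x = (\<Sum>\<sigma>\<in>F. c \<sigma> * b \<sigma> x)"
  by (simp add: combination_def sum_apply scale_chain_def)

lemma combination_add: "combination b F (c + d) = combination b F c + combination b F d"
  by (simp add: fun_eq_iff combination_apply distrib_right sum.distrib)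

lemma combination_diff: "combination b F (c - d) = combination b F c - combination b F d"
  by (simp add: fun_eq_iff combination_apply left_diff_distrib sum_subtractf)

lemma combination_scale: "combination b F (scale_chain a c) = scale_chain a (combination b F c)"
  by (simp add: fun_eq_iff combination_apply scale_chain_def sum_distrib_left mult.assoc)

lemma combination_0: "combination b F 0 = 0"
  by (simp add: fun_eq_iff combination_apply)

lemma combination_unit: "finite F \<Longrightarrow> \<sigma> \<in> F \<Longrightarrow> combination b F (unit_chain \<sigma>) = b \<sigma>"
  by (simp add: fun_eq_iff combination_apply unit_chain_def if_distrib[of "\<lambda>x. x * _"] cong: if_cong)

lemma combination_units: "finite F \<Longrightarrow> c \<in> supported F \<Longrightarrow> combination unit_chain F c = c"
  by (auto simp: fun_eq_iff combination_apply unit_chain_def supported_def if_distrib[of "\<lambda>x. _ * x"] cong: if_cong)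

lemma subspace_supported: "chain.subspace (supported F)"
  by (intro chain.subspaceI) (auto simp: supported_def scale_chain_def)

lemma unit_chain_supported: "\<sigma> \<in> F \<Longrightarrow> unit_chain \<sigma> \<in> supported F"
  by (auto simp: unit_chain_def supported_def)

lemma supported_subset_span:
  assumes F: "finite F" shows "supported F \<subseteq> chain.span (unit_chain ` F)"
proof
  fix c assume c: "c \<in> supported F"
  have "combination unit_chain F c \<in> chain.span (unit_chain ` F)"
    unfolding combination_def by (intro chain.span_sum chain.span_scale chain.span_base) auto
  then show "c \<in> chain.span (unit_chain ` F)" using combination_units[OF F c] by simp
qed

lemma combination_image: "finite F \<Longrightarrow> combination b F ` supported F = chain.span (b ` F)"
proof
  assume F: "finite F"
  show "combination b F ` supported F \<subseteq> chain.span (b ` F)"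
    unfolding combination_def by (intro image_subsetI chain.span_sum chain.span_scale chain.span_base) auto
  show "chain.span (b ` F) \<subseteq> combination b F ` supported F"
  proof (rule chain.span_minimal)
    show "b ` F \<subseteq> combination b F ` supported F"
    proof (rule image_subsetI)
      fix \<sigma> assume \<sigma>: "\<sigma> \<in> F"
      show "b \<sigma> \<in> combination b F ` supported F"
        by (rule image_eqI[of _ _ "unit_chain \<sigma>"]) (simp_all add: combination_unit F \<sigma> unit_chain_supported)
    qed
    show "chain.subspace (combination b F ` supported F)"
    proof (rule chain.subspaceI)
      show "0 \<in> combination b F ` supported F"
        using combination_0[of b F] chain.subspace_0[OF subspace_supported] by (metis imageI)
      show "x + y \<in> combination b F ` supported F"
        if "x \<in> combination b F ` supported F" "y \<in> combination b F ` supported F" for x y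
        using that by (auto simp flip: combination_add intro!: imageI chain.subspace_add[OF subspace_supported])
      show "scale_chain a x \<in> combination b F ` supported F" if "x \<in> combination b F ` supported F" for a x
        using that by (auto simp flip: combination_scale intro!: imageI chain.subspace_scale[OF subspace_supported])
    qed
  qed
qed

lemma combination_mono_neutral:
  assumes "finite F" "I \<subseteq> F" "\<And>i. i \<notin> I \<Longrightarrow> a i = 0"
  shows "combination b F a = combination b I a"
  unfolding combination_def using assms by (intro sum.mono_neutral_right) (auto simp: scale_chain_def)

lemma dim_zero_subspace: "chain.dim {0} = 0"
  using chain.dim_eq_card[of "{}" "{0}"] chain.independent_empty by simp

lemma dim_supported: assumes F: "finite F" shows "chain.dim (supported F :: ('c \<Rightarrow> 'k::field_char_0) set) = card F"
proof -
  have "chain.dim (supported F :: ('c \<Rightarrow> 'k) set) = card F + chain.dim {0 :: 'c \<Rightarrow> 'k}"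
  proof (rule chain.dim_modulo[where T="unit_chain ` F" and z=unit_chain])
    fix c :: "'c \<Rightarrow> 'k" assume c: "c \<in> supported F"
    have eq: "c - (\<Sum>i\<in>F. scale_chain (a i) (unit_chain i)) \<in> {0} \<longleftrightarrow> combination unit_chain F a = c" for a
      by (auto simp: combination_def)
    show "\<exists>!a. (\<forall>i. i \<notin> F \<longrightarrow> a i = 0) \<and> c - (\<Sum>i\<in>F. scale_chain (a i) (unit_chain i)) \<in> {0}"
      unfolding eq
    proof (rule ex1I[of _ c])
      show "(\<forall>i. i \<notin> F \<longrightarrow> c i = 0) \<and> combination unit_chain F c = c"
        using c combination_units[OF F c] by (auto simp: supported_def)
      show "a = c" if "(\<forall>i. i \<notin> F \<longrightarrow> a i = 0) \<and> combination unit_chain F a = c" for a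
        using combination_units[OF F, of a] that by (simp add: supported_def)
    qed
  next
    show "{0 :: 'c \<Rightarrow> 'k} \<subseteq> supported F" using chain.subspace_0[OF subspace_supported] by simp
  qed (simp_all add: F subspace_supported supported_subset_span unit_chain_supported chain.subspace_single_0)
  then show ?thesis by (simp add: dim_zero_subspace)
qed

text \<open>Rank-nullity. If \<open>b\<close> maps \<open>I\<close> injectively onto a basis of the
  image, the unit chains of \<open>I\<close> represent the domain uniquely modulo the kernel, and
  \<open>dim_modulo\<close> counts.\<close>

lemma dim_kernel_combination:
  fixes b :: "'c \<Rightarrow> 'd \<Rightarrow> 'k::field_char_0"
  assumes F: "finite F"
  shows "chain.dim {c \<in> supported F. combination b F c = 0} + chain.dim (chain.span (b ` F)) = card F"
proof -
  let ?K = "{c \<in> supported F. combination b F c = 0}"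
  obtain I where I: "I \<subseteq> F" "inj_on b I" "chain.independent (b ` I)" "chain.span (b ` I) = chain.span (b ` F)"
  proof -
    \<comment> \<open>With all times 0 the greedy choice is an ordinary choice of a basis among the
      vectors, read off at \<open>s = 0\<close>.\<close>
    obtain I where I: "I \<subseteq> F" "inj_on b I" "chain.independent (b ` I)"
      "\<forall>s. chain.span (b ` {i\<in>I. 0 \<le> s}) = chain.span (b ` {i\<in>F. (0::real) \<le> s})"
      using chain.greedy_basis[OF F, of b "\<lambda>_. 0"] by blast
    show thesis using that[OF I(1-3)] I(4)[THEN spec, of 0] by simp
  qed
  have finI: "finite I" using I(1) F finite_subset by blast
  have K: "chain.subspace ?K"
    using chain.subspace_0[OF subspace_supported] chain.subspace_add[OF subspace_supported] chain.subspace_scale[OF subspace_supported]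
    by (intro chain.subspaceI) (auto simp: combination_0 combination_add combination_scale)
  have "chain.dim (supported F :: ('c \<Rightarrow> 'k) set) = card I + chain.dim ?K"
  proof (rule chain.dim_modulo[where T="unit_chain ` F" and z=unit_chain])
    fix c :: "'c \<Rightarrow> 'k" assume c: "c \<in> supported F"
    \<comment> \<open>Applying the map given by \<open>b\<close> turns representation modulo the
      kernel into representation of the image vector by the basis. The empty difference matches the
      form of \<open>representation_modulo_complement\<close>.\<close>
    have eq: "c - combination unit_chain I a \<in> ?K \<longleftrightarrow> combination b F c - combination b I a \<in> chain.span (b ` I - b ` I)"
      if a: "\<forall>i. i \<notin> I \<longrightarrow> a i = 0" for a
    proof -
      have sa: "a \<in> supported F" using a I(1) by (auto simp: supported_def)
      have "combination unit_chain I a = a"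
        using a combination_units[OF finI] by (auto simp: supported_def)
      moreover have "combination b F a = combination b I a"
        using F I(1) a by (intro combination_mono_neutral) auto
      ultimately show ?thesis
        using chain.subspace_diff[OF subspace_supported c sa] by (simp add: combination_diff)
    qed
    have "(\<lambda>a. (\<forall>i. i \<notin> I \<longrightarrow> a i = 0) \<and> c - combination unit_chain I a \<in> ?K)
      = (\<lambda>a. (\<forall>i. i \<notin> I \<longrightarrow> a i = 0) \<and> combination b F c - combination b I a \<in> chain.span (b ` I - b ` I))"
      by (intro ext conj_cong refl eq)
    moreover have "\<exists>!a. (\<forall>i. i \<notin> I \<longrightarrow> a i = 0) \<and> combination b F c - combination b I a \<in> chain.span (b ` I - b ` I)"
      unfolding combination_def[of b I]
    proof (rule chain.representation_modulo_complement)
      show "combination b F c \<in> chain.span (b ` I)"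
        using imageI[OF c, of "combination b F"] by (simp only: combination_image[OF F] I(4))
    qed (use I finI in auto)
    ultimately show "\<exists>!a. (\<forall>i. i \<notin> I \<longrightarrow> a i = 0) \<and> c - (\<Sum>i\<in>I. scale_chain (a i) (unit_chain i)) \<in> ?K"
      unfolding combination_def[of unit_chain I] by (simp only:)
  next
    show "unit_chain i \<in> supported F" if "i \<in> I" for i using that I(1) by (intro unit_chain_supported) auto
    show "?K \<subseteq> supported F" by blast
  qed (simp_all add: F finI K subspace_supported supported_subset_span)
  moreover have "chain.dim (chain.span (b ` F)) = card I"
    using chain.dim_span_eq_card_independent[OF I(3)] card_image[OF I(2)] I(4) by simp
  moreover have "chain.dim (supported F :: ('c \<Rightarrow> 'k) set) = card F" by (rule dim_supported[OF F])
  ultimately show ?thesis by simp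
qed

lemma cellular_chains_eq: "cellular_chains Y k = supported (cells Y k)"
  by (simp add: cellular_chains_def supported_def)

lemma cellular_boundary_eq: "cellular_boundary Y k = combination (boundary_vector Y k) (cells Y (Suc k))"
  by (auto simp: fun_eq_iff cellular_boundary_def combination_apply boundary_vector_def mult.commute)

lemma boundaries_eq: "finite (cells Y (Suc k)) \<Longrightarrow> boundaries Y k = chain.span (boundary_vector Y k ` cells Y (Suc k))"
  unfolding boundaries_def cellular_chains_eq cellular_boundary_eq by (rule combination_image)

lemma subspace_reduced_cycles: "chain.subspace (reduced_cycles Y k)"
proof (cases k)
  case 0
  then show ?thesis
    by (auto intro!: chain.subspaceI simp: cellular_chains_def scale_chain_def sum.distrib simp flip: sum_distrib_left)
next
  case (Suc j)
  then show ?thesis using chain.subspace_0[OF subspace_supported] chain.subspace_add[OF subspace_supported] chain.subspace_scale[OF subspace_supported]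
    by (intro chain.subspaceI)
      (auto simp: cellular_chains_eq cellular_boundary_eq combination_0 combination_add combination_scale)
qed

lemma reduced_cycles_supported: "reduced_cycles Y k \<subseteq> supported (cells Y k)"
  by (cases k) (auto simp: cellular_chains_eq)

context finite_complex begin

text \<open>Here topology passes into linear algebra: the composition law of the incidence numbers
  covers positive degrees, and the augmentation formula covers degree 0, where reduced cycles have
  coefficient sum 0.\<close>

lemma boundary_vector_cycle: "(boundary_vector X k \<sigma> :: 'c \<Rightarrow> 'k::field_char_0) \<in> reduced_cycles X k"
proof (cases k)
  case 0
  have "of_int (\<Sum>v\<in>cells X 0. incidence X 0 \<sigma> v) = (0 :: 'k)"
    using incidence_augmentation[of \<sigma>] by simp
  then show ?thesis using 0 by (simp add: boundary_vector_def cellular_chains_def)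
next
  case (Suc j)
  have "combination (boundary_vector X j) (cells X k) (boundary_vector X k \<sigma>) \<rho> = (0 :: 'k)" for \<rho>
  proof (cases "\<rho> \<in> cells X j")
    case True
    have "of_int (\<Sum>\<tau>\<in>cells X k. incidence X k \<sigma> \<tau> * incidence X j \<tau> \<rho>) = (0 :: 'k)"
      using incidence_incidence[OF True, of \<sigma>] Suc by simp
    then show ?thesis using True by (simp add: combination_apply boundary_vector_def)
  qed (simp add: combination_apply boundary_vector_def)
  then show ?thesis using Suc
    by (simp add: cellular_chains_def cellular_boundary_eq fun_eq_iff boundary_vector_def)
qed

section \<open>Cycles, boundaries and Betti numbers of X_F\<close>

lemma boundary_vector_add_cells:
  assumes "F \<subseteq> cells X l" "Suc k \<le> l" "\<sigma> \<in> cells (add_cells X l F) (Suc k)"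
  shows "boundary_vector (add_cells X l F) k \<sigma> = boundary_vector X k \<sigma>"
  unfolding boundary_vector_def incidence_add_cells[OF assms] using assms(2) by (simp add: cells_add_cells)

lemma reduced_cycles_add_cells:
  assumes "F \<subseteq> cells X l" "k < l"
  shows "(reduced_cycles (add_cells X l F) k :: ('c \<Rightarrow> 'k::field_char_0) set) = reduced_cycles X k"
proof (cases k)
  case 0
  then show ?thesis using assms by (simp add: cellular_chains_def cells_add_cells)
next
  case (Suc j)
  have "combination (boundary_vector (add_cells X l F) j) (cells X k) c = combination (boundary_vector X j) (cells X k) c" for c :: "'c \<Rightarrow> 'k"
    unfolding combination_def
    by (intro sum.cong refl) (use assms Suc in \<open>simp add: boundary_vector_add_cells cells_add_cells\<close>)
  then show ?thesis using assms Suc by (simp add: cellular_chains_def cells_add_cells cellular_boundary_eq)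
qed

definition boundary_span :: "nat \<Rightarrow> 'c set \<Rightarrow> ('c \<Rightarrow> 'k::field_char_0) set" where
  "boundary_span k F = chain.span (boundary_vector X k ` F)"

lemma boundaries_add_cells:
  assumes "F \<subseteq> cells X (Suc k)"
  shows "boundaries (add_cells X (Suc k) F) k = boundary_span k F"
proof -
  have "finite F" using assms finite_cells finite_subset by blast
  then have "boundaries (add_cells X (Suc k) F) k = chain.span (boundary_vector (add_cells X (Suc k) F) k ` F)"
    using boundaries_eq[of "add_cells X (Suc k) F" k] by (simp add: cells_add_cells)
  also have "boundary_vector (add_cells X (Suc k) F) k ` F = boundary_vector X k ` F"
    using assms by (intro image_cong refl boundary_vector_add_cells) (auto simp: cells_add_cells)
  finally show ?thesis by (simp add: boundary_span_def)
qed

lemma boundary_span_subset: "boundary_span k F \<subseteq> reduced_cycles X k"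
  unfolding boundary_span_def using boundary_vector_cycle
  by (intro chain.span_minimal subspace_reduced_cycles) auto

lemma reduced_betti_lower:
  assumes "F \<subseteq> cells X (Suc k)"
  shows "reduced_betti TYPE('k::field_char_0) k (add_cells X (Suc k) F)
    = chain.dim (reduced_cycles X k :: ('c \<Rightarrow> 'k) set) - chain.dim (boundary_span k F :: ('c \<Rightarrow> 'k) set)"
  using assms by (simp add: reduced_betti_def boundaries_add_cells reduced_cycles_add_cells)

text \<open>There are no cells above dimension \<open>Suc k\<close>, so the only boundary is 0; the
  Betti number is the dimension of the kernel of the boundary map on \<open>F\<close>, and
  rank-nullity applies. The form as a sum avoids truncated subtraction.\<close>

lemma reduced_betti_upper:
  assumes "F \<subseteq> cells X (Suc k)"
  shows "reduced_betti TYPE('k::field_char_0) (Suc k) (add_cells X (Suc k) F) + chain.dim (boundary_span k F :: ('c \<Rightarrow> 'k) set) = card F"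
proof -
  let ?Y = "add_cells X (Suc k) F"
  have F: "finite F" using assms finite_cells finite_subset by blast
  have "combination (boundary_vector ?Y k) F c = combination (boundary_vector X k) F c" for c :: "'c \<Rightarrow> 'k"
    unfolding combination_def
    by (intro sum.cong refl) (use assms in \<open>simp add: boundary_vector_add_cells cells_add_cells\<close>)
  then have "reduced_cycles ?Y (Suc k) = {c \<in> supported F. combination (boundary_vector X k :: _ \<Rightarrow> _ \<Rightarrow> 'k) F c = 0}"
    by (simp add: cellular_chains_eq cellular_boundary_eq cells_add_cells)
  moreover have "boundaries ?Y (Suc k) = {0 :: 'c \<Rightarrow> 'k}"
    using boundaries_eq[of ?Y "Suc k"] by (simp add: cells_add_cells)
  ultimately show ?thesis using dim_kernel_combination[OF F, of "boundary_vector X k :: _ \<Rightarrow> _ \<Rightarrow> 'k"]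
    by (simp add: reduced_betti_def boundary_span_def dim_zero_subspace)
qed

lemma reduced_cycles_finite_dim: "reduced_cycles X k \<subseteq> chain.span (unit_chain ` cells X k)"
  using reduced_cycles_supported supported_subset_span[OF finite_cells] by blast

text \<open>Boundaries are cycles. This makes the subtraction in \<open>reduced_betti_lower\<close>
  exact, on which the cancellation of ranks in the Tutte polynomial depends.\<close>

lemma dim_boundary_span_le:
  "chain.dim (boundary_span k F :: ('c \<Rightarrow> 'k::field_char_0) set) \<le> chain.dim (reduced_cycles X k :: ('c \<Rightarrow> 'k) set)"
proof -
  obtain S :: "('c \<Rightarrow> 'k) set" where S: "S \<subseteq> boundary_span k F" "chain.independent S" "boundary_span k F \<subseteq> chain.span S" "card S = chain.dim (boundary_span k F :: ('c \<Rightarrow> 'k) set)"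
    using chain.basis_exists[of "boundary_span k F :: ('c \<Rightarrow> 'k) set"] .
  obtain T :: "('c \<Rightarrow> 'k) set" where T: "T \<subseteq> reduced_cycles X k" "chain.independent T" "reduced_cycles X k \<subseteq> chain.span T" "card T = chain.dim (reduced_cycles X k :: ('c \<Rightarrow> 'k) set)"
    using chain.basis_exists[of "reduced_cycles X k :: ('c \<Rightarrow> 'k) set"] .
  have "T \<subseteq> chain.span (unit_chain ` cells X k)" using T(1) reduced_cycles_finite_dim by (rule subset_trans)
  from chain.independent_span_bound[OF finite_imageI[OF finite_cells] T(2) this] have "finite T" ..
  moreover have "S \<subseteq> chain.span T" using S(1) boundary_span_subset T(3) by (rule subset_trans[OF subset_trans])
  ultimately have "card S \<le> card T" using chain.independent_span_bound[OF _ S(2)] by simp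
  then show ?thesis using S(4) T(4) by simp
qed

end


section \<open>The barcode\<close>

text \<open>The classes alive at time \<open>s\<close> form a basis of the homology, so their number
  is its dimension. Monotonicity guarantees that a cycle born earlier is still a cycle at time
  \<open>s\<close>.\<close>

lemma barcode_alive_card:
  fixes Y :: "real \<Rightarrow> ('a, 'c) cell_complex"
  assumes bc: "barcode TYPE('k::field_char_0) k Y bs"
    and mono: "\<And>s s'. 0 \<le> s \<Longrightarrow> s \<le> s' \<Longrightarrow> s' \<le> 1 \<Longrightarrow>
      (reduced_cycles (Y s) k :: ('c \<Rightarrow> 'k) set) \<subseteq> reduced_cycles (Y s') k"
    and bnd: "(boundaries (Y s) k :: ('c \<Rightarrow> 'k) set) \<subseteq> reduced_cycles (Y s) k"
    and fin: "\<And>j. finite (cells (Y s) j)" and s: "s \<in> {0..1}"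
  shows "card {i. i < length bs \<and> fst (bs ! i) \<le> s \<and> ereal s < snd (bs ! i)} = reduced_betti TYPE('k) k (Y s)"
proof -
  let ?J = "{i. i < length bs \<and> fst (bs ! i) \<le> s \<and> ereal s < snd (bs ! i)}"
  obtain z :: "nat \<Rightarrow> 'c \<Rightarrow> 'k" where
    z: "\<forall>i<length bs. z i \<in> reduced_cycles (Y (fst (bs ! i))) k" and
    z': "\<forall>s\<in>{0..1}.
           (\<forall>i<length bs. snd (bs ! i) \<le> ereal s \<longrightarrow> z i \<in> boundaries (Y s) k) \<and>
           (let alive = {i. i < length bs \<and> fst (bs ! i) \<le> s \<and> ereal s < snd (bs ! i)} in
              \<forall>c\<in>reduced_cycles (Y s) k. \<exists>!a. (\<forall>i. i \<notin> alive \<longrightarrow> a i = 0) \<and>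
                 c - (\<Sum>i\<in>alive. scale_chain (a i) (z i)) \<in> boundaries (Y s) k)"
    using conjunct2[OF bc[unfolded barcode_def]] by (elim exE conjE) (rule that)
  have rep: "\<forall>c\<in>reduced_cycles (Y s) k. \<exists>!a. (\<forall>i. i \<notin> ?J \<longrightarrow> a i = 0) \<and>
                 c - (\<Sum>i\<in>?J. scale_chain (a i) (z i)) \<in> boundaries (Y s) k"
    using conjunct2[OF bspec[OF z' s]] by (simp only: Let_def)
  have birth: "0 \<le> fst (bs ! i)" if "i < length bs" for i
    using bc nth_mem[OF that] unfolding barcode_def by (auto simp: case_prod_beta)
  have "chain.dim (reduced_cycles (Y s) k :: ('c \<Rightarrow> 'k) set) = card ?J + chain.dim (boundaries (Y s) k :: ('c \<Rightarrow> 'k) set)"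
  proof (rule chain.dim_modulo)
    show "chain.subspace (reduced_cycles (Y s) k :: ('c \<Rightarrow> 'k) set)" by (rule subspace_reduced_cycles)
    show "chain.subspace (boundaries (Y s) k :: ('c \<Rightarrow> 'k) set)"
      unfolding boundaries_eq[OF fin] by (rule chain.subspace_span)
    show "finite (unit_chain ` cells (Y s) k :: ('c \<Rightarrow> 'k) set)" using fin by simp
    show "(reduced_cycles (Y s) k :: ('c \<Rightarrow> 'k) set) \<subseteq> chain.span (unit_chain ` cells (Y s) k)"
      using reduced_cycles_supported supported_subset_span[OF fin] by (rule subset_trans)
    show "z i \<in> reduced_cycles (Y s) k" if "i \<in> ?J" for i
      using that z birth[of i] mono[of "fst (bs ! i)" s] s by auto
  qed (use bnd rep in auto)
  then show ?thesis by (simp add: reduced_betti_def)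
qed

text \<open>A bar that dies gives a half-open interval, one that survives gives an interval closed
  at 1; endpoints have measure 0, so both integrals are the capped length.\<close>

lemma bar_integral:
  assumes "b \<in> {0..1}" "ereal b < d" "d \<le> 1 \<or> d = \<infinity>"
  shows "integrable lborel (\<lambda>s. indicator {0..1} s * of_bool (b \<le> s \<and> ereal s < d) :: real)" (is "integrable _ ?f")
    and "(\<integral>s. indicator {0..1} s * of_bool (b \<le> s \<and> ereal s < d) \<partial>lborel) = real_of_ereal (min d 1) - b"
proof -
  have "integrable lborel ?f \<and> integral\<^sup>L lborel ?f = real_of_ereal (min d 1) - b"
  proof (cases d)
    case (real r)
    then have r: "b < r" "r \<le> 1" using assms by (auto simp: one_ereal_def)
    then have "?f = indicator {b..<r}"
      using assms real by (auto simp: fun_eq_iff indicator_def)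
    moreover have "min d 1 = ereal r" using real r by (simp add: min_def one_ereal_def)
    ultimately show ?thesis using r by simp
  next
    case PInf
    then have "?f = indicator {b..1}"
      using assms by (auto simp: fun_eq_iff indicator_def)
    then show ?thesis using PInf assms(1) by simp
  qed (use assms in auto)
  then show "integrable lborel ?f" "integral\<^sup>L lborel ?f = real_of_ereal (min d 1) - b" by auto
qed

text \<open>A bar contributes the time during which it is alive, and summing over the bars at a
  fixed time counts those alive. The right-hand side does not mention the barcode, as the
  \<open>THE\<close> in \<open>lifetime_sum\<close> requires.\<close>

lemma total_lifetime_eq_integral:
  fixes Y :: "real \<Rightarrow> ('a, 'c) cell_complex"
  assumes bc: "barcode TYPE('k::field_char_0) k Y bs"
    and mono: "\<And>s s'. 0 \<le> s \<Longrightarrow> s \<le> s' \<Longrightarrow> s' \<le> 1 \<Longrightarrow>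
      (reduced_cycles (Y s) k :: ('c \<Rightarrow> 'k) set) \<subseteq> reduced_cycles (Y s') k"
    and bnd: "\<And>s. (boundaries (Y s) k :: ('c \<Rightarrow> 'k) set) \<subseteq> reduced_cycles (Y s) k"
    and fin: "\<And>s j. finite (cells (Y s) j)"
  shows "total_lifetime bs = (\<integral>s. indicator {0..1} s * real (reduced_betti TYPE('k) k (Y s)) \<partial>lborel)"
proof -
  let ?g = "\<lambda>i s. indicator {0..1} s * of_bool (fst (bs ! i) \<le> s \<and> ereal s < snd (bs ! i)) :: real"
  have bar: "fst (bs ! i) \<in> {0..1}" "ereal (fst (bs ! i)) < snd (bs ! i)" "snd (bs ! i) \<le> 1 \<or> snd (bs ! i) = \<infinity>"
    if "i < length bs" for i
    using bc nth_mem[OF that] unfolding barcode_def by (auto simp: case_prod_beta)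
  have "total_lifetime bs = (\<Sum>i<length bs. real_of_ereal (min (snd (bs ! i)) 1) - fst (bs ! i))"
    by (simp add: total_lifetime_def sum_list_sum_nth case_prod_beta atLeast0LessThan)
  also have "\<dots> = (\<Sum>i<length bs. integral\<^sup>L lborel (?g i))"
    by (intro sum.cong refl bar_integral(2)[symmetric] bar) auto
  also have "\<dots> = (\<integral>s. (\<Sum>i<length bs. ?g i s) \<partial>lborel)"
    by (intro Bochner_Integration.integral_sum[symmetric] bar_integral(1) bar) auto
  also have "\<dots> = (\<integral>s. indicator {0..1} s * real (reduced_betti TYPE('k) k (Y s)) \<partial>lborel)"
  proof (rule Bochner_Integration.integral_cong[OF refl])
    fix s
    show "(\<Sum>i<length bs. ?g i s) = indicator {0..1} s * real (reduced_betti TYPE('k) k (Y s))"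
    proof (cases "s \<in> {0..1}")
      case True
      have "(\<Sum>i<length bs. ?g i s) = real (card ({..<length bs} \<inter> {i. fst (bs ! i) \<le> s \<and> ereal s < snd (bs ! i)}))"
        using True by (simp add: of_bool_def sum.If_cases)
      also have "{..<length bs} \<inter> {i. fst (bs ! i) \<le> s \<and> ereal s < snd (bs ! i)}
          = {i. i < length bs \<and> fst (bs ! i) \<le> s \<and> ereal s < snd (bs ! i)}" by auto
      finally show ?thesis using barcode_alive_card[OF bc mono bnd fin True] True by simp
    qed simp
  qed
  finally show ?thesis .
qed

context finite_complex begin

text \<open>The \<open>k\<close>-cells are all present from the start, so the cycles are constant in
  time and every bar is born at 0. A greedy basis of the boundaries is extended to a basis
  \<open>W\<close> of the cycles. A vector of the greedy basis dies when its cell arrives, the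
  others never.\<close>

lemma barcode_exists:
  fixes t :: "'c \<Rightarrow> real"
  shows "\<exists>bs. barcode TYPE('k::field_char_0) k (\<lambda>s. add_cells X (Suc k) {\<sigma> \<in> cells X (Suc k). t \<sigma> \<le> s}) bs"
proof -
  let ?b = "boundary_vector X k :: 'c \<Rightarrow> 'c \<Rightarrow> 'k" and ?Z = "reduced_cycles X k :: ('c \<Rightarrow> 'k) set"
  let ?F = "\<lambda>s. {\<sigma> \<in> cells X (Suc k). t \<sigma> \<le> s}"
  obtain I where I: "I \<subseteq> cells X (Suc k)" "inj_on ?b I" "chain.independent (?b ` I)"
    "\<And>s. chain.span (?b ` {i\<in>I. t i \<le> s}) = chain.span (?b ` ?F s)"
    using chain.greedy_basis[OF finite_cells[of "Suc k"], of ?b t] by blast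
  have "?b ` I \<subseteq> ?Z" using boundary_vector_cycle by blast
  from chain.maximal_independent_subset_extend[OF this I(3)]
  obtain W where W: "?b ` I \<subseteq> W" "W \<subseteq> ?Z" "chain.independent W" "?Z \<subseteq> chain.span W" .
  have "W \<subseteq> chain.span (unit_chain ` cells X k)" using W(2) reduced_cycles_finite_dim by (rule subset_trans)
  from chain.independent_span_bound[OF finite_imageI[OF finite_cells] W(3) this] have finW: "finite W" ..
  \<comment> \<open>The times are arbitrary reals here, since uniformity confines them to [0, 1]
    only almost surely. A cell with a time above 1 counts as never arriving.\<close>
  define d where "d w = (if w \<in> ?b ` I \<and> t (inv_into I ?b w) \<le> 1 then ereal (t (inv_into I ?b w)) else \<infinity>)" for w
  \<comment> \<open>Vectors with death time at most 0 are boundaries from the start; they yield no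
    bar, because a bar must have positive length.\<close>
  obtain ws where ws: "set ws = {w \<in> W. 0 < d w}" "distinct ws"
    using finite_distinct_list[of "{w \<in> W. 0 < d w}"] finW by auto
  define bs where "bs = map (\<lambda>w. (0::real, d w)) ws"
  have len: "length bs = length ws" and nth: "\<And>i. i < length ws \<Longrightarrow> bs ! i = (0, d (ws ! i))"
    by (simp_all add: bs_def)
  have wsW: "ws ! i \<in> W" if "i < length ws" for i using nth_mem[OF that] ws(1) by auto
  have cyc: "reduced_cycles (add_cells X (Suc k) (?F s)) k = ?Z" for s
    by (intro reduced_cycles_add_cells) auto
  have bou: "boundaries (add_cells X (Suc k) (?F s)) k = chain.span (?b ` {i\<in>I. t i \<le> s})" for s
    by (subst boundaries_add_cells) (auto simp: boundary_span_def I(4))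
  have db: "d (?b i) = (if t i \<le> 1 then ereal (t i) else \<infinity>)" if "i \<in> I" for i
    using that I(2) by (simp add: d_def)
  \<comment> \<open>By the greedy choice these vectors span the boundaries at time \<open>s\<close>,
    so representation modulo boundaries becomes representation modulo the dead part of the
    basis.\<close>
  have dead: "{w \<in> W. d w \<le> ereal s} = ?b ` {i\<in>I. t i \<le> s}" if s: "s \<in> {0..1}" for s
  proof
    show "{w \<in> W. d w \<le> ereal s} \<subseteq> ?b ` {i\<in>I. t i \<le> s}"
    proof clarify
      fix w assume w: "w \<in> W" "d w \<le> ereal s"
      then have "w \<in> ?b ` I" by (auto simp: d_def split: if_splits)
      then obtain i where "i \<in> I" "w = ?b i" by blast
      then show "w \<in> ?b ` {i\<in>I. t i \<le> s}" using w(2) db[of i] by (auto split: if_splits)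
    qed
    show "?b ` {i\<in>I. t i \<le> s} \<subseteq> {w \<in> W. d w \<le> ereal s}"
      using W(1) db s by auto
  qed
  have "barcode TYPE('k) k (\<lambda>s. add_cells X (Suc k) (?F s)) bs"
    unfolding barcode_def cyc bou Let_def
  proof (intro conjI exI[of _ "\<lambda>i. ws ! i"] ballI allI impI)
    show "case x of (b, d) \<Rightarrow> b \<in> {0..1} \<and> ereal b < d \<and> (d \<le> 1 \<or> d = \<infinity>)" if "x \<in> set bs" for x
      using that ws(1) by (auto simp: bs_def zero_ereal_def one_ereal_def d_def split: if_splits)
    show "ws ! i \<in> ?Z" if "i < length bs" for i using that wsW W(2) len by auto
    fix s :: real assume s: "s \<in> {0..1}"
    show "ws ! i \<in> chain.span (?b ` {i\<in>I. t i \<le> s})" if "i < length bs" "snd (bs ! i) \<le> ereal s" for i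
      using that wsW[of i] nth[of i] len unfolding dead[OF s, symmetric] by (intro chain.span_base) auto
    let ?J = "{i. i < length bs \<and> fst (bs ! i) \<le> s \<and> ereal s < snd (bs ! i)}"
    have J: "?J = {i. i < length ws \<and> ereal s < d (ws ! i)}" using s by (auto simp: len nth)
    \<comment> \<open>The discarded vectors have death time at most 0 and are therefore not alive at
      any \<open>s\<close> in [0, 1].\<close>
    have "(\<lambda>i. ws ! i) ` ?J = {w \<in> W. ereal s < d w}"
    proof
      show "(\<lambda>i. ws ! i) ` ?J \<subseteq> {w \<in> W. ereal s < d w}" unfolding J using wsW by auto
      show "{w \<in> W. ereal s < d w} \<subseteq> (\<lambda>i. ws ! i) ` ?J"
      proof clarify
        fix w assume w: "w \<in> W" "ereal s < d w"
        have "0 \<le> ereal s" using s by (simp add: zero_ereal_def)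
        then have "0 < d w" using w(2) by (rule le_less_trans)
        then have "w \<in> set ws" using w(1) ws(1) by simp
        then obtain i where "i < length ws" "ws ! i = w" by (auto simp: in_set_conv_nth)
        then show "w \<in> (\<lambda>i. ws ! i) ` ?J" unfolding J using w(2) by auto
      qed
    qed
    then have "W - (\<lambda>i. ws ! i) ` ?J = {w \<in> W. d w \<le> ereal s}" by auto
    then have compl: "W - (\<lambda>i. ws ! i) ` ?J = ?b ` {i\<in>I. t i \<le> s}" using dead[OF s] by simp
    fix c assume c: "c \<in> ?Z"
    show "\<exists>!a. (\<forall>i. i \<notin> ?J \<longrightarrow> a i = 0) \<and> c - (\<Sum>i\<in>?J. scale_chain (a i) (ws ! i)) \<in> chain.span (?b ` {i\<in>I. t i \<le> s})"
      unfolding compl[symmetric]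
    proof (rule chain.representation_modulo_complement[OF W(3)])
      show "inj_on (\<lambda>i. ws ! i) ?J" unfolding J using ws(2) by (auto intro!: inj_onI simp: nth_eq_iff_index_eq)
      show "(\<lambda>i. ws ! i) ` ?J \<subseteq> W" unfolding J using wsW by auto
      show "c \<in> chain.span W" using c W(4) by blast
    qed simp
  qed
  then show ?thesis by blast
qed

lemma finite_cells_add_cells: "F \<subseteq> cells X l \<Longrightarrow> finite (cells (add_cells X l F) j)"
  using finite_cells[of j] finite_cells[of l] finite_subset by (auto simp: add_cells_def)

text \<open>The identity holds at every sample point, so measurability and integrability of the
  lifetime sum can be read off from the integral.\<close>

lemma lifetime_sum_eq_integral:
  "lifetime_sum TYPE('k::field_char_0) k (bernoulli_process X (Suc k) t \<omega>) =
    (\<integral>s. indicator {0..1} s * real (reduced_betti TYPE('k) k (bernoulli_process X (Suc k) t \<omega> s)) \<partial>lborel)"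
proof -
  let ?Y = "bernoulli_process X (Suc k) t \<omega>"
  have Y: "?Y = (\<lambda>s. add_cells X (Suc k) {\<sigma> \<in> cells X (Suc k). t \<sigma> \<omega> \<le> s})"
    by (simp add: bernoulli_process_def fun_eq_iff)
  have cyc: "(reduced_cycles (?Y s) k :: ('c \<Rightarrow> 'k) set) = reduced_cycles X k" for s
    unfolding Y by (intro reduced_cycles_add_cells) auto
  have bou: "(boundaries (?Y s) k :: ('c \<Rightarrow> 'k) set) \<subseteq> reduced_cycles (?Y s) k" for s
    unfolding cyc unfolding Y by (subst boundaries_add_cells) (auto intro: subsetD[OF boundary_span_subset])
  have fin: "finite (cells (?Y s) j)" for s j unfolding Y by (intro finite_cells_add_cells) auto
  have eq: "total_lifetime bs = (\<integral>s. indicator {0..1} s * real (reduced_betti TYPE('k) k (?Y s)) \<partial>lborel)"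
    if "barcode TYPE('k) k ?Y bs" for bs
    by (rule total_lifetime_eq_integral[OF that _ bou fin]) (simp add: cyc)
  obtain bs where "barcode TYPE('k) k ?Y bs"
    using barcode_exists[of k "\<lambda>\<sigma>. t \<sigma> \<omega>"] unfolding Y by blast
  then show ?thesis unfolding lifetime_sum_def using eq by (intro the_equality) auto
qed

end


section \<open>Uniform random times\<close>

locale uniform_process = prob_space M for M :: "'w measure" +
  fixes E :: "'c set" and t :: "'c \<Rightarrow> 'w \<Rightarrow> real"
  assumes finite_E: "finite E"
    and indep: "indep_vars (\<lambda>_. borel) t E"
    and uniform: "\<And>\<sigma>. \<sigma> \<in> E \<Longrightarrow> distr M borel (t \<sigma>) = uniform_measure lborel {0..1}"
begin

lemma measurable_t[measurable]: "\<sigma> \<in> E \<Longrightarrow> t \<sigma> \<in> borel_measurable M"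
  using indep by (auto simp: indep_vars_def)

lemma prob_le:
  assumes "\<sigma> \<in> E" "s \<in> {0..1}"
  shows "prob (t \<sigma> -` {..s} \<inter> space M) = s" "prob (t \<sigma> -` {s<..} \<inter> space M) = 1 - s"
proof -
  have t: "t \<sigma> \<in> borel_measurable M" using assms by measurable
  have "{0..1} \<inter> {..s} = {0..s}" "{0..1} \<inter> {s<..} = {s<..1}" using assms by auto
  then have "measure (uniform_measure lborel {0..1}) {..s} = s" "measure (uniform_measure lborel {0..1}) {s<..} = 1 - s"
    using assms by (simp_all add: measure_uniform_measure)
  then show "prob (t \<sigma> -` {..s} \<inter> space M) = s" "prob (t \<sigma> -` {s<..} \<inter> space M) = 1 - s"
    using uniform[OF assms(1)] measure_distr[OF t, of "{..s}"] measure_distr[OF t, of "{s<..}"] by auto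
qed

lemma prob_subset:
  assumes F: "F \<subseteq> E" and s: "s \<in> {0..1}"
  shows "prob {\<omega>\<in>space M. {\<sigma>\<in>E. t \<sigma> \<omega> \<le> s} = F} = s ^ card F * (1 - s) ^ (card E - card F)"
\<comment> \<open>An intersection over the empty index set would be the whole type rather than the
  sample space, and the product rule asks for a nonempty set of indices.\<close>
proof (cases "E = {}")
  case True
  then show ?thesis using F by (simp add: prob_space)
next
  case False
  let ?A = "\<lambda>\<sigma>. if \<sigma> \<in> F then {..s} else {s<..}"
  have eq: "{\<omega>\<in>space M. {\<sigma>\<in>E. t \<sigma> \<omega> \<le> s} = F} = (\<Inter>\<sigma>\<in>E. t \<sigma> -` ?A \<sigma> \<inter> space M)"
    using F False by (auto split: if_splits)
  have "prob (\<Inter>\<sigma>\<in>E. t \<sigma> -` ?A \<sigma> \<inter> space M) = (\<Prod>\<sigma>\<in>E. prob (t \<sigma> -` ?A \<sigma> \<inter> space M))"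
    using indep_varsD_finite[OF indep False finite_E, of ?A] by auto
  also have "\<dots> = (\<Prod>\<sigma>\<in>E. if \<sigma> \<in> F then s else 1 - s)"
    using prob_le[OF _ s] by (intro prod.cong) auto
  also have "\<dots> = s ^ card (E \<inter> F) * (1 - s) ^ card (E - F)"
    using finite_E by (simp add: prod.If_cases Diff_eq Collect_neg_eq[symmetric])
  also have "\<dots> = s ^ card F * (1 - s) ^ (card E - card F)"
    using F finite_E by (simp add: Int_absorb1 card_Diff_subset finite_subset)
  finally show ?thesis using eq by simp
qed

lemma sets_event:
  assumes "F \<subseteq> E"
  shows "{\<omega>\<in>space M. {\<sigma>\<in>E. t \<sigma> \<omega> \<le> s} = F} \<in> sets M"
proof -
  have e: "{\<sigma>\<in>E. t \<sigma> \<omega> \<le> s} = F \<longleftrightarrow> (\<forall>\<sigma>\<in>E. (t \<sigma> \<omega> \<le> s) = (\<sigma> \<in> F))" for \<omega> using assms by auto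
  have "Measurable.pred M (\<lambda>\<omega>. \<forall>\<sigma>\<in>E. (t \<sigma> \<omega> \<le> s) = (\<sigma> \<in> F))"
  proof (intro pred_intros_finite finite_E)
    fix \<sigma> assume \<sigma>: "\<sigma> \<in> E"
    have [measurable]: "t \<sigma> \<in> borel_measurable M" using \<sigma> by measurable
    show "Measurable.pred M (\<lambda>\<omega>. (t \<sigma> \<omega> \<le> s) = (\<sigma> \<in> F))" by measurable
  qed
  then show ?thesis unfolding e pred_def .
qed

text \<open>The integrand depends on the random times only through the random set of cells present,
  which takes finitely many values. This gives joint measurability and boundedness, so that Fubini
  applies.\<close>

lemma expectation_integral:
  fixes g :: "'c set \<Rightarrow> real"
  defines "L \<equiv> \<lambda>\<omega>. \<integral>s. indicator {0..1} s * g {\<sigma>\<in>E. t \<sigma> \<omega> \<le> s} \<partial>lborel"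
  shows "integrable M L"
    and "expectation L = (LBINT s:{0<..<1}. (\<Sum>F\<in>Pow E. g F * (s ^ card F * (1 - s) ^ (card E - card F))))"
proof -
  let ?H = "\<lambda>\<omega> s. indicator {0..1} s * g {\<sigma>\<in>E. t \<sigma> \<omega> \<le> s} :: real"
  let ?p = "\<lambda>s. \<Sum>F\<in>Pow E. g F * (s ^ card F * (1 - s) ^ (card E - card F))"
  interpret P: pair_sigma_finite M lborel ..
  have split: "g {\<sigma>\<in>E. t \<sigma> \<omega> \<le> s} = (\<Sum>F\<in>Pow E. g F * of_bool ({\<sigma>\<in>E. t \<sigma> \<omega> \<le> s} = F))" for \<omega> s
  proof -
    have "(\<Sum>F\<in>Pow E. g F * of_bool ({\<sigma>\<in>E. t \<sigma> \<omega> \<le> s} = F)) = (\<Sum>F\<in>{{\<sigma>\<in>E. t \<sigma> \<omega> \<le> s}}. g F * of_bool ({\<sigma>\<in>E. t \<sigma> \<omega> \<le> s} = F))"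
      using finite_E by (intro sum.mono_neutral_right) auto
    then show ?thesis by simp
  qed
  have meas1: "(\<lambda>z. of_bool ({\<sigma>\<in>E. t \<sigma> (fst z) \<le> snd z} = F) :: real) \<in> borel_measurable (M \<Otimes>\<^sub>M lborel)"
    if "F \<subseteq> E" for F
  proof -
    have e: "{\<sigma>\<in>E. t \<sigma> \<omega> \<le> s} = F \<longleftrightarrow> (\<forall>\<sigma>\<in>E. (t \<sigma> \<omega> \<le> s) = (\<sigma> \<in> F))" for \<omega> s using that by auto
    have "Measurable.pred (M \<Otimes>\<^sub>M lborel) (\<lambda>z. \<forall>\<sigma>\<in>E. (t \<sigma> (fst z) \<le> snd z) = (\<sigma> \<in> F))"
    proof (intro pred_intros_finite finite_E)
      fix \<sigma> assume \<sigma>: "\<sigma> \<in> E"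
      have [measurable]: "t \<sigma> \<in> borel_measurable M" using \<sigma> by measurable
      show "Measurable.pred (M \<Otimes>\<^sub>M lborel) (\<lambda>z. (t \<sigma> (fst z) \<le> snd z) = (\<sigma> \<in> F))" by measurable
    qed
    then show ?thesis unfolding e by measurable
  qed
  have meas: "case_prod ?H \<in> borel_measurable (M \<Otimes>\<^sub>M lborel)"
    unfolding case_prod_beta' split
    by (intro borel_measurable_times borel_measurable_sum borel_measurable_const meas1) (auto intro: measurable_compose[OF measurable_snd])
  define C where "C = (\<Sum>F\<in>Pow E. \<bar>g F\<bar>)"
  have bound: "\<bar>g {\<sigma>\<in>E. t \<sigma> \<omega> \<le> s}\<bar> \<le> C" for \<omega> s
    unfolding C_def using finite_E by (intro member_le_sum[where f="\<lambda>F. \<bar>g F\<bar>"]) auto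
  have C0: "C \<ge> 0" unfolding C_def by (intro sum_nonneg) auto
  have int: "integrable (M \<Otimes>\<^sub>M lborel) (case_prod ?H)"
  proof (rule Bochner_Integration.integrable_bound[OF _ meas])
    show "integrable (M \<Otimes>\<^sub>M lborel) (\<lambda>z. C * indicator (space M \<times> {0..1::real}) z)"
    proof (intro integrable_mult_right integrable_real_indicator)
      have I: "{0..1::real} \<in> sets lborel" by measurable
      show "space M \<times> {0..1::real} \<in> sets (M \<Otimes>\<^sub>M lborel)"
        using I by (intro pair_measureI) auto
      show "emeasure (M \<Otimes>\<^sub>M lborel) (space M \<times> {0..1::real}) < \<infinity>"
        using lborel.emeasure_pair_measure_Times[OF sets.top I, of M] by (simp add: emeasure_space_1)
    qed
    show "AE z in M \<Otimes>\<^sub>M lborel. norm (case_prod ?H z) \<le> norm (C * indicator (space M \<times> {0..1::real}) z)"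
      by (rule AE_I2) (use bound C0 in \<open>auto simp: space_pair_measure indicator_def abs_mult split: if_splits\<close>)
  qed
  show "integrable M L" unfolding L_def using P.integrable_fst[OF int] by simp
  have "expectation L = (\<integral>s. (\<integral>\<omega>. ?H \<omega> s \<partial>M) \<partial>lborel)"
    unfolding L_def using P.Fubini_integral[OF int] by simp
  also have "\<dots> = (LBINT s:{0<..<1}. ?p s)"
    unfolding set_lebesgue_integral_def
  proof (rule integral_cong_AE)
    \<comment> \<open>The endpoints are discarded as a null set: the lifetime integral runs over
      [0, 1], the target integral over the open interval. Outside [0, 1] both sides are 0.\<close>
    have "s \<noteq> 0 \<and> s \<noteq> 1 \<longrightarrow> (\<integral>\<omega>. ?H \<omega> s \<partial>M) = indicat_real {0<..<1} s *\<^sub>R ?p s" for s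
    proof (intro impI, cases "s \<in> {0..1}")
      case True
      have "(\<integral>\<omega>. ?H \<omega> s \<partial>M) = (\<integral>\<omega>. (\<Sum>F\<in>Pow E. g F * indicator {\<omega>\<in>space M. {\<sigma>\<in>E. t \<sigma> \<omega> \<le> s} = F} \<omega>) \<partial>M)"
        using True by (intro Bochner_Integration.integral_cong refl) (simp add: split indicator_def of_bool_def)
      also have "\<dots> = (\<Sum>F\<in>Pow E. g F * prob {\<omega>\<in>space M. {\<sigma>\<in>E. t \<sigma> \<omega> \<le> s} = F})"
      proof (subst Bochner_Integration.integral_sum)
        fix F assume F: "F \<in> Pow E"
        have "{\<omega>\<in>space M. {\<sigma>\<in>E. t \<sigma> \<omega> \<le> s} = F} \<in> sets M" using F by (intro sets_event) auto
        then show "integrable M (\<lambda>\<omega>. g F * indicator {\<omega>\<in>space M. {\<sigma>\<in>E. t \<sigma> \<omega> \<le> s} = F} \<omega>)"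
          by (intro integrable_mult_right integrable_real_indicator) (auto simp: emeasure_eq_measure)
      qed (simp add: Int_def cong: conj_cong)
      finally show "s \<noteq> 0 \<and> s \<noteq> 1 \<Longrightarrow> (\<integral>\<omega>. ?H \<omega> s \<partial>M) = indicat_real {0<..<1} s *\<^sub>R ?p s"
        using True prob_subset[OF _ True] by (simp add: indicator_def)
    qed (auto simp: indicator_def)
    moreover have "AE s in lborel. s \<noteq> 0 \<and> s \<noteq> (1::real)" using AE_lborel_singleton by (intro AE_conjI) auto
    ultimately show "AE s in lborel. (\<integral>\<omega>. ?H \<omega> s \<partial>M) = indicat_real {0<..<1} s *\<^sub>R ?p s"
      by (auto elim: AE_mp)
    show "(\<lambda>s. \<integral>\<omega>. ?H \<omega> s \<partial>M) \<in> borel_measurable lborel"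
      using borel_measurable_integrable[OF P.integrable_snd[OF int]] by simp
  qed measurable
  finally show "expectation L = (LBINT s:{0<..<1}. ?p s)" .
qed

end


section \<open>The expected lifetime sum\<close>

theorem theorem4p1:
  fixes X :: "('a, 'c) cell_complex" and l :: nat
    and M :: "'w measure" and t :: "'c \<Rightarrow> 'w \<Rightarrow> real"
  defines "L \<equiv> \<lambda>\<omega>. lifetime_sum TYPE('k::field_char_0) (l - 1) (bernoulli_process X l t \<omega>)"
    and "T \<equiv> tutte TYPE('k) l X"
  defines "f \<equiv> \<lambda>s. (1 - s) / s *
                    (deriv (\<lambda>x. T x (1 / (1 - s))) (1 / s) / T (1 / s) (1 / (1 - s)))"
  assumes "finite_cell_complex X" and "topspace (top_space X) \<noteq> {}" and "l \<ge> 1"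
    and "prob_space M"
    and "prob_space.indep_vars M (\<lambda>_. borel) t (cells X l)"
    and "\<And>\<sigma>. \<sigma> \<in> cells X l \<Longrightarrow> distr M borel (t \<sigma>) = uniform_measure lborel {0..1}"
  shows "integrable M L \<and> set_integrable lborel {0<..<1} f \<and>
         (\<integral>\<omega>. L \<omega> \<partial>M) = (LBINT s:{0<..<1}. f s)"
proof -
  interpret X: finite_complex X by unfold_locales fact
  obtain k where l: "l = Suc k" using assms by (cases l) auto
  let ?E = "cells X l"
  interpret prob_space M by fact
  interpret U: uniform_process M ?E t by unfold_locales (use assms X.finite_cells in auto)
  define z where "z = chain.dim (reduced_cycles X k :: ('c \<Rightarrow> 'k) set)"
  define r where "r F = chain.dim (X.boundary_span k F :: ('c \<Rightarrow> 'k) set)" for F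
  define g where "g F = real (reduced_betti TYPE('k) k (add_cells X l F))" for F
  define p where "p s = (\<Sum>F\<in>Pow ?E. g F * (s ^ card F * (1 - s) ^ (card ?E - card F)))" for s :: real
  have lower: "reduced_betti TYPE('k) k (add_cells X l F) = z - r F"
    and upper: "reduced_betti TYPE('k) l (add_cells X l F) + r F = card F"
    and r_le: "r F \<le> z" if "F \<subseteq> ?E" for F
    using X.reduced_betti_lower[of F k] X.reduced_betti_upper[of F k] X.dim_boundary_span_le[of k F] that
    by (auto simp: l z_def r_def)
  have L: "L = (\<lambda>\<omega>. \<integral>s. indicator {0..1} s * g {\<sigma>\<in>?E. t \<sigma> \<omega> \<le> s} \<partial>lborel)"
    by (simp add: L_def l X.lifetime_sum_eq_integral g_def bernoulli_process_def)
  have T: "T x y = (\<Sum>F\<in>Pow ?E. (x - 1) ^ (z - r F) * (y - 1) ^ (card F - r F))" for x y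
    unfolding T_def tutte_def
  proof (intro sum.cong refl)
    fix F assume F: "F \<in> Pow ?E"
    then have "reduced_betti TYPE('k) l (add_cells X l F) = card F - r F" using upper[of F] by simp
    then show "(x - 1) ^ reduced_betti TYPE('k) (l - 1) (add_cells X l F) * (y - 1) ^ reduced_betti TYPE('k) l (add_cells X l F)
        = (x - 1) ^ (z - r F) * (y - 1) ^ (card F - r F)"
      using lower[of F] F by (simp add: l)
  qed
  have f: "f s = p s" if s: "s \<in> {0<..<1}" for s
  proof -
    \<comment> \<open>The odds of a cell being present. At the chosen arguments x - 1 and y - 1 are
      reciprocal, namely 1/q and q, and the prefactor of the integrand is again x - 1.\<close>
    define q where "q = s / (1 - s)"
    have q: "q > 0" "1 / (1 - s) - 1 = q" "1 / s - 1 = 1 / q" "(1 - s) / s = 1 / q"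
      using s by (auto simp: q_def field_simps)
    \<comment> \<open>Both truncated subtractions are exact, because \<open>r F\<close> is at most
      \<open>z\<close> and at most \<open>card F\<close>; the exponents of q then add up to |F| -
      z.\<close>
    have w: "(1 / q) ^ (z - r F) * q ^ (card F - r F) = q ^ card F / q ^ z" if "F \<subseteq> ?E" for F
    proof -
      have "r F \<le> card F" using upper[OF that] by simp
      then have "q ^ z = q ^ (z - r F) * q ^ r F" "q ^ card F = q ^ (card F - r F) * q ^ r F"
        using r_le[OF that] by (simp_all flip: power_add)
      then show ?thesis using q(1) by (simp add: power_one_over field_simps)
    qed
    have "((\<lambda>x. T x (1 / (1 - s))) has_field_derivative
        (\<Sum>F\<in>Pow ?E. real (z - r F) * (1 / s - 1) ^ (z - r F - 1) * (1 / (1 - s) - 1) ^ (card F - r F))) (at (1 / s))"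
      unfolding T by (auto intro!: derivative_eq_intros sum.cong)
    then have "deriv (\<lambda>x. T x (1 / (1 - s))) (1 / s)
        = (\<Sum>F\<in>Pow ?E. real (z - r F) * (1 / q) ^ (z - r F - 1) * q ^ (card F - r F))"
      unfolding q(2,3) by (rule DERIV_imp_deriv)
    then have "(1 - s) / s * deriv (\<lambda>x. T x (1 / (1 - s))) (1 / s)
        = (\<Sum>F\<in>Pow ?E. (1 / q) * (real (z - r F) * (1 / q) ^ (z - r F - 1) * q ^ (card F - r F)))"
      unfolding q(4) by (simp add: sum_distrib_left)
    also have "\<dots> = (\<Sum>F\<in>Pow ?E. g F * (q ^ card F / q ^ z))"
    proof (intro sum.cong refl)
      fix F assume F: "F \<in> Pow ?E"
      \<comment> \<open>The prefactor restores the power lost by differentiation. For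
        \<open>n = 0\<close> the exponent \<open>n - 1\<close> is truncated to 0, but the factor
        \<open>n\<close> makes both sides 0.\<close>
      have "(1 / q) * (real n * (1 / q) ^ (n - 1)) = real n * (1 / q) ^ n" for n :: nat
        by (cases n) auto
      then have "(1 / q) * (real (z - r F) * (1 / q) ^ (z - r F - 1) * q ^ (card F - r F))
          = real (z - r F) * ((1 / q) ^ (z - r F) * q ^ (card F - r F))"
        by (metis mult.assoc)
      then show "(1 / q) * (real (z - r F) * (1 / q) ^ (z - r F - 1) * q ^ (card F - r F)) = g F * (q ^ card F / q ^ z)"
        using F w[of F] lower[of F] by (simp add: g_def)
    qed
    also have "\<dots> = (\<Sum>F\<in>Pow ?E. g F * q ^ card F) / q ^ z"
      by (simp add: sum_divide_distrib)
    finally have num: "(1 - s) / s * deriv (\<lambda>x. T x (1 / (1 - s))) (1 / s) = (\<Sum>F\<in>Pow ?E. g F * q ^ card F) / q ^ z" .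
    have "T (1 / s) (1 / (1 - s)) = (\<Sum>F\<in>Pow ?E. q ^ card F / q ^ z)"
      unfolding T q(2,3) using w by (intro sum.cong) auto
    also have "\<dots> = (\<Sum>F\<in>Pow ?E. q ^ card F) / q ^ z" by (simp add: sum_divide_distrib)
    \<comment> \<open>The sum over all subsets is the expansion of a product of factors q + 1, one
      for each cell.\<close>
    also have "(\<Sum>F\<in>Pow ?E. q ^ card F) = (q + 1) ^ card ?E"
      using prod_add[OF X.finite_cells[of l], of "\<lambda>_. q" "\<lambda>_. 1"] by (simp add: mult.commute)
    also have "q + 1 = 1 / (1 - s)" using s by (simp add: q_def field_simps)
    finally have den: "T (1 / s) (1 / (1 - s)) = (1 / (1 - s)) ^ card ?E / q ^ z" .
    have "f s = ((1 - s) / s * deriv (\<lambda>x. T x (1 / (1 - s))) (1 / s)) / T (1 / s) (1 / (1 - s))"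
      by (simp add: f_def)
    also have "\<dots> = ((\<Sum>F\<in>Pow ?E. g F * q ^ card F) / q ^ z) / ((1 / (1 - s)) ^ card ?E / q ^ z)"
      by (simp only: num den)
    also have "\<dots> = (\<Sum>F\<in>Pow ?E. g F * q ^ card F) * (1 - s) ^ card ?E"
      using q(1) s by (simp add: power_one_over)
    also have "\<dots> = p s"
      unfolding p_def sum_distrib_right
    proof (intro sum.cong refl)
      fix F assume "F \<in> Pow ?E"
      then have "card F \<le> card ?E" using X.finite_cells by (simp add: card_mono)
      then have "(1 - s) ^ card ?E = (1 - s) ^ (card ?E - card F) * (1 - s) ^ card F"
        by (simp flip: power_add)
      then show "g F * q ^ card F * (1 - s) ^ card ?E = g F * (s ^ card F * (1 - s) ^ (card ?E - card F))"
        using s by (simp add: q_def power_divide)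
    qed
    finally show ?thesis .
  qed
  \<comment> \<open>\<open>p\<close> is a polynomial, hence integrable on the closed interval.
    Agreement with \<open>f\<close> is available on the open interval, where the divisions in
    \<open>f\<close> are genuine.\<close>
  have "set_integrable lborel {0..1} p"
    unfolding p_def by (intro borel_integrable_atLeastAtMost' continuous_intros)
  then have "set_integrable lborel {0<..<1} p"
    by (rule set_integrable_subset) auto
  then have int: "set_integrable lborel {0<..<1} f"
    using f by (subst set_integrable_cong[OF refl refl]) auto
  have "(LBINT s:{0<..<1}. f s) = (LBINT s:{0<..<1}. p s)"
    using f by (intro set_lebesgue_integral_cong) auto
  then show ?thesis
    using U.expectation_integral[of g] int unfolding L p_def by simp
qed


end
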